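(* Let $u\in\ell^2(\mathbb{Z})$, let $u^\#$ be its Fourier rearrangement, and let $k\ge 0$ (an integer). Then $$\text{(i)}\quad \sum_{n\in\mathbb{Z}}|\Delta^k u(n)|^2\;\ge\;\sum_{n\in\mathbb{Z}}|\Delta^k u^\#(n)|^2$$ and $$\text{(ii)}\quad \sum_{n\in\mathbb{Z}}|D(\Delta^k u)(n)|^2\;\ge\;\sum_{n\in\mathbb{Z}}|D(\Delta^k u^\#)(n)|^2 .$$ Moreover, equality holds in (i) or (ii) if and only if $|F(u)(x)|=F(u)^*(x)$ for a.e. $x\in(-\pi,\pi)$.
   Context: For $u:\mathbb{Z}\to\mathbb{C}$, $Du(n):=u(n)-u(n-1)$ and $\Delta u(n):=2u(n)-u(n-1)-u(n+1)$; $\Delta^k$ is the $k$-fold iterate of $\Delta$. The Fourier transform $F:\ell^2(\mathbb{Z})\to L^2((-\pi,\pi))$ is $F(u)(x):=(2\pi)^{-1/2}\sum_{n\in\mathbb{Z}}u(n)e^{-inx}$, with inverse $F^{-1}(g)(n)=(2\pi)^{-1/2}\int_{-\pi}^{\pi}g(x)e^{inx}\,dx$. For a measurable $f$ on $\mathbb{R}$ all of whose level sets $\{|f|>t\}$, $t>0$, have finite measure, its symmetric-decreasing rearrangement is $f^*(x):=\int_0^\infty\chi_{\{|f|>t\}^*}(x)\,dt$, where $A^*$ is the open interval centred at $0$ with the same Lebesgue measure as $A$. For $f$ on $(-\pi,\pi)$, $f$ is extended by $0$ to $\mathbb{R}$ and $f^*$ is regarded as a function on $(-\pi,\pi)$.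 The Fourier rearrangement of $u\in\ell^2(\mathbb{Z})$ is $u^\#:=F^{-1}\big((F(u))^*\big)$.
   Formalization: For k = 0 equality in (i) holds for every u (Plancherel), e.g. when F(u) is the indicator of (0,1), where |F(u)| differs from F(u)^*; so the equality case of (i) is stated as: equality iff k = 0 or |F(u)| = F(u)^* a.e. *)

theory Defs
  imports "HOL-Analysis.Analysis"
begin

definition bdiff :: "(int \<Rightarrow> complex) \<Rightarrow> int \<Rightarrow> complex" where
  "bdiff u n = u n - u (n - 1)"

definition disc_laplacian :: "(int \<Rightarrow> complex) \<Rightarrow> int \<Rightarrow> complex" where
  "disc_laplacian u n = 2 * u n - u (n - 1) - u (n + 1)"

definition ell2 :: "(int \<Rightarrow> complex) set" where
  "ell2 = {u. (\<lambda>n. (cmod (u n))\<^sup>2) summable_on UNIV}"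

text \<open>The sum takes values in the extended nonnegative reals, so a divergent sum has
  value infinity rather than the default value 0.\<close>

definition sq_sum :: "(int \<Rightarrow> complex) \<Rightarrow> ennreal" where
  "sq_sum u = (\<Sum>\<^sub>\<infinity>n\<in>UNIV. ennreal ((cmod (u n))\<^sup>2))"

abbreviation circ :: "real measure" where
  "circ \<equiv> lebesgue_on {-pi<..<pi}"

definition fourier_partial :: "(int \<Rightarrow> complex) \<Rightarrow> int set \<Rightarrow> real \<Rightarrow> complex" where
  "fourier_partial u A x =
     of_real (1 / sqrt (2 * pi)) * (\<Sum>n\<in>A. u n * exp (- (\<i> * of_int n * of_real x)))"

text \<open>The Fourier series of a square-summable sequence converges (unconditionally) in the
  space of square-integrable functions on the open interval from \<open>-pi\<close> to \<open>pi\<close>; its sum is a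
  class of functions modulo almost everywhere equality.\<close>

definition is_fourier :: "(int \<Rightarrow> complex) \<Rightarrow> (real \<Rightarrow> complex) \<Rightarrow> bool" where
  "is_fourier u f \<longleftrightarrow>
     f \<in> borel_measurable circ \<and> integrable circ (\<lambda>x. (cmod (f x))\<^sup>2) \<and>
     ((\<lambda>A. LINT x|circ. (cmod (f x - fourier_partial u A x))\<^sup>2) \<longlongrightarrow> 0)
       (finite_subsets_at_top UNIV)"

text \<open>A representative of that class. It exists by Riesz-Fischer, and everything below
  depends on it only up to null sets.\<close>

definition fourier :: "(int \<Rightarrow> complex) \<Rightarrow> real \<Rightarrow> complex" where
  "fourier u = (SOME f. is_fourier u f)"

definition inv_fourier :: "(real \<Rightarrow> complex) \<Rightarrow> int \<Rightarrow> complex" where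
  "inv_fourier g n =
     of_real (1 / sqrt (2 * pi)) * (LINT x|circ. g x * exp (\<i> * of_int n * of_real x))"

text \<open>Meant for measurable sets of finite measure.\<close>

definition set_rearr :: "real set \<Rightarrow> real set" where
  "set_rearr A = {- (measure lebesgue A / 2) <..< measure lebesgue A / 2}"

text \<open>For \<open>x \<noteq> 0\<close> the integrand vanishes for large \<open>t\<close> as soon as the level sets have finite
  measure and \<open>f\<close> is finite-valued. Only at \<open>x = 0\<close> can the integral diverge
  (for essentially unbounded \<open>f\<close>); there the value is then 0 instead of infinity, on a
  null set.\<close>

definition sym_decr_rearr :: "(real \<Rightarrow> complex) \<Rightarrow> real \<Rightarrow> real" where
  "sym_decr_rearr f x =
     (LINT t:{0<..}|lborel. indicator (set_rearr {y. cmod (f y) > t}) x)"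

definition extend_zero :: "(real \<Rightarrow> complex) \<Rightarrow> real \<Rightarrow> complex" where
  "extend_zero f x = (if x \<in> {-pi<..<pi} then f x else 0)"

definition circ_rearr :: "(real \<Rightarrow> complex) \<Rightarrow> real \<Rightarrow> real" where
  "circ_rearr f = sym_decr_rearr (extend_zero f)"

definition fourier_rearr :: "(int \<Rightarrow> complex) \<Rightarrow> int \<Rightarrow> complex" where
  "fourier_rearr u = inv_fourier (\<lambda>x. of_real (circ_rearr (fourier u) x))"

end

theory Submission imports Defs begin

text \<open>On the Fourier side \<open>disc_laplacian\<close> is multiplication by \<open>2 - 2 * cos x\<close> and \<open>bdiff\<close> is
  multiplication by \<open>1 - exp (- \<i> * x)\<close>, whose squared modulus is again \<open>2 - 2 * cos x\<close>. By Parseval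
  the sums are therefore the integrals of \<open>(cmod (fourier u x))\<^sup>2\<close> against \<open>(2 - 2 * cos x) ^ m\<close> with
  \<open>m = 2 * k\<close> or \<open>m = 2 * k + 1\<close>. This weight increases with \<open>\<bar>x\<bar>\<close>, so among all sets of a given measure
  its integral is smallest on the centred interval (strictly so if \<open>m > 0\<close>); integrating this bathtub
  principle over the super-level sets gives the inequality and its equality case. The weight is
  constant for \<open>m = 0\<close>, which is why equality always holds in the first inequality when \<open>k = 0\<close>.\<close>

section \<open>Square-integrable functions and Fourier coefficients\<close>

text \<open>The two sequences enter differently: \<open>u\<close> through a chosen representative
  \<open>fourier u\<close>, \<open>fourier_rearr u\<close> as the coefficients of an explicit
  function. Both are brought to the form \<open>inv_fourier h\<close> with \<open>h\<close>
  square-integrable, so Parseval has to hold for every such \<open>h\<close>, not only for the sum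
  of a given series. This takes completeness of the characters, obtained from Stone-Weierstrass, in
  addition to Riesz-Fischer. The rearrangement is controlled pointwise only away from 0, where its
  defining integral may diverge; all later comparisons are therefore almost everywhere. For the
  equality case the weighted integrals must be finite, since otherwise nothing follows from equal
  integrals of ordered functions; boundedness of the weight ensures this.\<close>

lemma finite_measure_circ: "finite_measure circ"
  by (rule finite_measure_lebesgue_on) simp

interpretation circ: finite_measure circ
  by (rule finite_measure_circ)

lemma space_circ [simp]: "space circ = {-pi<..<pi}"
  by (simp add: space_restrict_space)

lemma measurable_circ_borel [measurable (raw)]: "f \<in> borel_measurable borel \<Longrightarrow> f \<in> borel_measurable circ"
  by (simp add: measurable_completion measurable_restrict_space1)

definition square_integrable :: "(real \<Rightarrow> complex) \<Rightarrow> bool" where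
  "square_integrable h \<longleftrightarrow> h \<in> borel_measurable circ \<and> integrable circ (\<lambda>x. (cmod (h x))\<^sup>2)"

lemma square_integrable_measurable [measurable_dest]: "square_integrable h \<Longrightarrow> h \<in> borel_measurable circ"
  by (simp add: square_integrable_def)

lemma square_integrable_dominated:
  assumes "integrable circ B" "g \<in> borel_measurable circ"
    and "\<And>x. x \<in> {-pi<..<pi} \<Longrightarrow> (cmod (g x))\<^sup>2 \<le> B x"
  shows "square_integrable g"
proof -
  note [measurable] = assms(2)
  have "integrable circ (\<lambda>x. (cmod (g x))\<^sup>2)"
    by (rule Bochner_Integration.integrable_bound[OF assms(1)])
       (auto intro!: AE_I2 order_trans[OF assms(3)])
  then show ?thesis by (simp add: square_integrable_def)
qed

lemma square_integrable_add:
  assumes "square_integrable f" "square_integrable g"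
  shows "square_integrable (\<lambda>x. f x + g x)"
proof -
  note [measurable] = assms[THEN square_integrable_measurable]
  have "integrable circ (\<lambda>x. 2 * (cmod (f x))\<^sup>2 + 2 * (cmod (g x))\<^sup>2)"
    using assms by (auto simp: square_integrable_def)
  moreover have "(cmod (f x + g x))\<^sup>2 \<le> 2 * (cmod (f x))\<^sup>2 + 2 * (cmod (g x))\<^sup>2" for x
  proof -
    have "(cmod (f x + g x))\<^sup>2 \<le> (cmod (f x) + cmod (g x))\<^sup>2"
      by (intro power_mono norm_triangle_ineq) auto
    also have "\<dots> \<le> 2 * (cmod (f x))\<^sup>2 + 2 * (cmod (g x))\<^sup>2"
      by (smt (verit) sum_squares_bound power2_sum)
    finally show ?thesis .
  qed
  ultimately show ?thesis by (intro square_integrable_dominated) auto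
qed

lemma square_integrable_bounded_mult:
  assumes f: "square_integrable f" and [measurable]: "b \<in> borel_measurable circ"
    and b: "\<And>x. x \<in> {-pi<..<pi} \<Longrightarrow> cmod (b x) \<le> C"
  shows "square_integrable (\<lambda>x. f x * b x)"
proof -
  note [measurable] = f[THEN square_integrable_measurable]
  have bound: "integrable circ (\<lambda>x. C\<^sup>2 * (cmod (f x))\<^sup>2)"
    using f by (auto simp: square_integrable_def)
  have "(cmod (f x * b x))\<^sup>2 \<le> C\<^sup>2 * (cmod (f x))\<^sup>2" if "x \<in> {-pi<..<pi}" for x
    using power_mono[OF b[OF that], of 2]
    by (simp add: norm_mult power_mult_distrib mult.commute[of "(cmod (f x))\<^sup>2"] mult_right_mono)
  then show ?thesis by (intro square_integrable_dominated[OF bound]) auto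
qed

lemma square_integrable_bounded:
  assumes [measurable]: "b \<in> borel_measurable circ"
    and b: "\<And>x. x \<in> {-pi<..<pi} \<Longrightarrow> cmod (b x) \<le> C"
  shows "square_integrable b"
  using square_integrable_bounded_mult[of "\<lambda>_. 1" b C] assms
  by (simp add: square_integrable_def)

lemma square_integrable_diff:
  assumes "square_integrable f" "square_integrable g"
  shows "square_integrable (\<lambda>x. f x - g x)"
  using square_integrable_add[OF assms(1) square_integrable_bounded_mult[OF assms(2), of "\<lambda>_. -1" 1]]
  by simp

lemma square_integrable_imp_integrable:
  assumes "square_integrable f"
  shows "integrable circ f"
proof -
  note [measurable] = assms[THEN square_integrable_measurable]
  have "integrable circ (\<lambda>x. 1 + (cmod (f x))\<^sup>2)"
    using assms by (auto simp: square_integrable_def)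
  \<comment> \<open>This follows from \<open>(cmod (f x) - 1)\<^sup>2 \<ge> 0\<close>; the constant
    1 is integrable because \<open>circ\<close> is a finite measure.\<close>
  moreover have "cmod (f x) \<le> 1 + (cmod (f x))\<^sup>2" for x
    using zero_le_power2[of "cmod (f x) - 1"] norm_ge_zero[of "f x"]
    unfolding power2_diff by (simp del: norm_ge_zero)
  ultimately show ?thesis
    by (intro Bochner_Integration.integrable_bound[of circ "\<lambda>x. 1 + (cmod (f x))\<^sup>2" f]) auto
qed

section \<open>Characters of the circle and their orthogonality\<close>

definition char_circ :: "int \<Rightarrow> real \<Rightarrow> complex" where
  "char_circ n x = exp (\<i> * of_int n * of_real x)"

lemma char_circ_measurable [measurable]: "char_circ n \<in> borel_measurable borel"
  unfolding char_circ_def [abs_def] by (intro borel_measurable_continuous_onI continuous_intros)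

lemma char_circ_measurable' [measurable]: "char_circ n \<in> borel_measurable circ"
  by measurable

lemma norm_char_circ [simp]: "cmod (char_circ n x) = 1"
  by (simp add: char_circ_def)

lemma char_circ_add: "char_circ (m + n) x = char_circ m x * char_circ n x"
  by (simp add: char_circ_def exp_add [symmetric] algebra_simps)

lemma cnj_char_circ: "cnj (char_circ n x) = char_circ (- n) x"
  by (simp add: char_circ_def exp_cnj)

lemma char_circ_0 [simp]: "char_circ 0 x = 1"
  by (simp add: char_circ_def)

lemma char_circ_cis: "char_circ n x = cis (of_int n * x)"
  by (simp add: char_circ_def cis_conv_exp mult.assoc)

text \<open>The series and the inverse transform carry opposite signs in the exponent, hence the
  index \<open>- n\<close> here and \<open>n\<close> in
  \<open>inv_fourier_char_circ\<close>.\<close>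

lemma fourier_partial_char_circ:
  "fourier_partial u A x = (\<Sum>n\<in>A. of_real (1 / sqrt (2 * pi)) * u n * char_circ (- n) x)"
  by (simp add: fourier_partial_def char_circ_def sum_distrib_left mult.assoc)

lemma inv_fourier_char_circ:
  "inv_fourier g n = of_real (1 / sqrt (2 * pi)) * (LINT x|circ. g x * char_circ n x)"
  by (simp add: inv_fourier_def char_circ_def)

lemma integrable_mult_char_circ:
  assumes "integrable circ h"
  shows "integrable circ (\<lambda>x. h x * char_circ n x)"
proof -
  have [measurable]: "h \<in> borel_measurable circ" using assms by auto
  show ?thesis
    by (rule Bochner_Integration.integrable_bound[OF assms]) (auto simp: norm_mult)
qed

lemma square_integrable_char_circ: "square_integrable (\<lambda>x. c * char_circ n x)"
  by (rule square_integrable_bounded[of _ "cmod c"]) (auto simp: norm_mult)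

lemma square_integrable_fourier_partial: "square_integrable (fourier_partial u A)"
proof (induction A rule: infinite_finite_induct)
  case (insert n A)
  then show ?case 
    using square_integrable_add[OF square_integrable_char_circ[of "of_real (1 / sqrt (2 * pi)) * u n" "- n"] insert.IH]
    by (simp add: fourier_partial_char_circ [abs_def])
qed (auto simp: fourier_partial_char_circ [abs_def] square_integrable_def)

text \<open>For \<open>n \<noteq> 0\<close> the primitive exp(i n x) / (i n) takes the same value at
  both endpoints, because \<open>n\<close> is an integer.\<close>

lemma integral_char_circ: "(LINT x|circ. char_circ n x) = (if n = 0 then of_real (2 * pi) else 0)"
proof (cases "n = 0")
  case True
  then show ?thesis by (simp add: measure_restrict_space scaleR_conv_of_real)
next
  case False
  have "(char_circ n has_integral
      (char_circ n pi / (\<i> * of_int n) - char_circ n (-pi) / (\<i> * of_int n))) {-pi..pi}"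
  proof (rule fundamental_theorem_of_calculus)
    fix x assume "x \<in> {-pi..pi}"
    have "((\<lambda>z. exp (\<i> * of_int n * z) / (\<i> * of_int n)) has_field_derivative char_circ n x)
            (at (complex_of_real x))"
      unfolding char_circ_def using False by (auto intro!: derivative_eq_intros)
    then show "((\<lambda>x. char_circ n x / (\<i> * of_int n)) has_vector_derivative char_circ n x)
                 (at x within {-pi..pi})"
      unfolding char_circ_def
      by (rule has_vector_derivative_real_field[THEN has_vector_derivative_at_within])
  qed simp
  moreover have "char_circ n pi = char_circ n (-pi)"
  proof -
    have "char_circ n pi = char_circ n (-pi) * cis (of_int n * (2 * pi))"
      by (simp add: char_circ_cis cis_mult mult.commute)
    also have "cis (of_int n * (2 * pi)) = 1"
      by (metis cis_multiple_2pi Ints_of_int mult.commute)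
    finally show ?thesis by simp
  qed
  ultimately have "(char_circ n has_integral 0) {-pi<..<pi}"
    by (simp add: has_integral_Icc_iff_Ioo)
  moreover have "integrable circ (char_circ n)"
    using square_integrable_imp_integrable[OF square_integrable_char_circ[of 1]] by simp
  ultimately show ?thesis using False
    by (subst lebesgue_integral_eq_integral) (auto simp: integral_unique)
qed

section \<open>Fourier coefficients and Bessel's inequality\<close>

lemma inv_fourier_diff:
  assumes "integrable circ f" "integrable circ g"
  shows "inv_fourier (\<lambda>x. f x - g x) n = inv_fourier f n - inv_fourier g n"
  using assms[THEN integrable_mult_char_circ, of n]
  by (simp add: inv_fourier_char_circ algebra_simps)

lemma inv_fourier_char_circ_self:
  "inv_fourier (\<lambda>x. of_real (1 / sqrt (2 * pi)) * u * char_circ (- m) x) n = (if m = n then u else 0)"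
proof -
  have "inv_fourier (\<lambda>x. of_real (1 / sqrt (2 * pi)) * u * char_circ (- m) x) n
      = of_real (1 / sqrt (2 * pi)) * (of_real (1 / sqrt (2 * pi)) * u * (LINT x|circ. char_circ (n - m) x))"
    unfolding inv_fourier_char_circ integral_mult_right_zero [symmetric]
    using char_circ_add[of n "-m"] by (simp add: mult_ac)
  also have "\<dots> = (if m = n then of_real (1 / sqrt (2 * pi) * (1 / sqrt (2 * pi)) * (2 * pi)) * u else 0)"
    by (auto simp: integral_char_circ simp flip: of_real_mult)
  also have "1 / sqrt (2 * pi) * (1 / sqrt (2 * pi)) * (2 * pi) = 1"
    by (simp add: divide_simps flip: real_sqrt_mult)
  finally show ?thesis by simp
qed

text \<open>Completing the square in \<open>c\<close>: the cross term is -2 times the real part of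
  \<open>cnj c * inv_fourier h n\<close>, and the factor 1 / sqrt(2 pi) makes the character a unit
  vector, so that the last term contributes exactly the squared modulus of \<open>c\<close>.\<close>

lemma integral_norm_diff_char_circ:
  assumes h: "square_integrable h"
  shows "(LINT x|circ. (cmod (h x - of_real (1 / sqrt (2 * pi)) * c * char_circ (- n) x))\<^sup>2)
    = (LINT x|circ. (cmod (h x))\<^sup>2) - (cmod (inv_fourier h n))\<^sup>2 + (cmod (c - inv_fourier h n))\<^sup>2"
proof -
  define s :: real where "s = 1 / sqrt (2 * pi)"
  have s: "s * s * (2 * pi) = 1" by (simp add: s_def divide_simps flip: real_sqrt_mult)
  define z where "z = (LINT x|circ. h x * char_circ n x)"
  have hn: "integrable circ (\<lambda>x. h x * char_circ n x)"
    by (intro integrable_mult_char_circ square_integrable_imp_integrable h)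
  have re: "integrable circ (\<lambda>x. Re (of_real s * cnj c * (h x * char_circ n x)))"
    by (intro integrable_Re integrable_mult_right hn)
  have "(cmod (h x - of_real s * c * char_circ (- n) x))\<^sup>2
      = (cmod (h x))\<^sup>2 - 2 * Re (of_real s * cnj c * (h x * char_circ n x)) + s\<^sup>2 * (cmod c)\<^sup>2" for x
  proof -
    have "(cmod (h x - of_real s * c * char_circ (- n) x))\<^sup>2 =
       (cmod (h x))\<^sup>2 - 2 * Re (h x * cnj (of_real s * c * char_circ (- n) x))
         + (cmod (of_real s * c * char_circ (- n) x))\<^sup>2"
      unfolding cmod_power2 by (simp add: power2_eq_square algebra_simps)
    then show ?thesis by (simp add: cnj_char_circ norm_mult power_mult_distrib mult_ac)
  qed
  then have "(LINT x|circ. (cmod (h x - of_real s * c * char_circ (- n) x))\<^sup>2)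
     = (LINT x|circ. (cmod (h x))\<^sup>2) - 2 * Re (of_real s * cnj c * z) + s\<^sup>2 * (cmod c)\<^sup>2 * (2 * pi)"
    using h re integral_Re[OF integrable_mult_right[OF hn], of "of_real s * cnj c"]
    unfolding square_integrable_def z_def integral_mult_right_zero
    by (simp add: measure_restrict_space del: times_complex.simps Re_complex_of_real)
  also have "s\<^sup>2 * (cmod c)\<^sup>2 * (2 * pi) = (cmod c)\<^sup>2"
    using s by (simp add: power2_eq_square mult_ac) 
  also have "Re (of_real s * cnj c * z) = Re (cnj c * inv_fourier h n)"
    by (simp add: inv_fourier_char_circ z_def s_def mult_ac)
  also have "(LINT x|circ. (cmod (h x))\<^sup>2) - 2 * Re (cnj c * inv_fourier h n) + (cmod c)\<^sup>2
    = (LINT x|circ. (cmod (h x))\<^sup>2) - (cmod (inv_fourier h n))\<^sup>2 + (cmod (c - inv_fourier h n))\<^sup>2"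
    unfolding cmod_power2 by (simp add: power2_eq_square algebra_simps)
  finally show ?thesis by (simp add: s_def)
qed

lemma inv_fourier_fourier_partial:
  "finite A \<Longrightarrow> inv_fourier (fourier_partial u A) n = (if n \<in> A then u n else 0)"
proof (induction A rule: finite_induct)
  case empty
  then show ?case by (simp add: inv_fourier_def fourier_partial_def)
next
  case (insert m A)
  have "inv_fourier (fourier_partial u (insert m A)) n =
     inv_fourier (\<lambda>x. fourier_partial u A x - of_real (1 / sqrt (2 * pi)) * (- u m) * char_circ (- m) x) n"
    using insert by (simp add: fourier_partial_char_circ [abs_def] add.commute)
  also have "\<dots> = inv_fourier (fourier_partial u A) n - (if m = n then - u m else 0)"
    using square_integrable_imp_integrable[OF square_integrable_char_circ]
      square_integrable_imp_integrable[OF square_integrable_fourier_partial]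
    by (subst inv_fourier_diff) (auto simp only: inv_fourier_char_circ_self)
  finally show ?case using insert by auto
qed

text \<open>The one-term identity is iterated: the partial sum over \<open>A\<close> has no
  coefficient at a new index \<open>m\<close>, so the residual has the same \<open>m\<close>-th
  coefficient as \<open>h\<close>. Taking for \<open>u\<close> the coefficients of \<open>h\<close>
  gives Bessel, and \<open>h = 0\<close> gives Pythagoras for finite sums.\<close>

lemma integral_norm_diff_fourier_partial:
  assumes h: "square_integrable h" and "finite A"
  shows "(LINT x|circ. (cmod (h x - fourier_partial u A x))\<^sup>2)
    = (LINT x|circ. (cmod (h x))\<^sup>2) - (\<Sum>n\<in>A. (cmod (inv_fourier h n))\<^sup>2)
        + (\<Sum>n\<in>A. (cmod (u n - inv_fourier h n))\<^sup>2)"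
  using \<open>finite A\<close>
proof (induction A rule: finite_induct)
  case empty
  then show ?case by (simp add: fourier_partial_def)
next
  case (insert m A)
  let ?g = "\<lambda>x. h x - fourier_partial u A x"
  have g: "square_integrable ?g"
    by (intro square_integrable_diff h square_integrable_fourier_partial)
  have "inv_fourier ?g m = inv_fourier h m"
    using insert h
    by (subst inv_fourier_diff)
       (auto simp: inv_fourier_fourier_partial square_integrable_imp_integrable square_integrable_fourier_partial)
  moreover have "(\<lambda>x. (cmod (h x - fourier_partial u (insert m A) x))\<^sup>2) =
      (\<lambda>x. (cmod (?g x - of_real (1 / sqrt (2 * pi)) * u m * char_circ (- m) x))\<^sup>2)"
    using insert by (simp add: fourier_partial_char_circ diff_diff_eq add.commute)
  ultimately show ?case
    using insert integral_norm_diff_char_circ[OF g, of "u m" m] by (simp only:) simp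
qed

lemma integral_norm_fourier_partial:
  assumes "finite A"
  shows "(LINT x|circ. (cmod (fourier_partial u A x))\<^sup>2) = (\<Sum>n\<in>A. (cmod (u n))\<^sup>2)"
  using integral_norm_diff_fourier_partial[of "\<lambda>_. 0" A u] assms
  by (simp add: square_integrable_def inv_fourier_def)

lemma bessel:
  assumes "square_integrable h" and "finite A"
  shows "(\<Sum>n\<in>A. (cmod (inv_fourier h n))\<^sup>2) \<le> (LINT x|circ. (cmod (h x))\<^sup>2)"
proof -
  have "0 \<le> (LINT x|circ. (cmod (h x - fourier_partial (inv_fourier h) A x))\<^sup>2)"
    by simp
  then show ?thesis by (simp add: integral_norm_diff_fourier_partial[OF assms])
qed

lemma inv_fourier_ell2:
  assumes "square_integrable h"
  shows "inv_fourier h \<in> ell2"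
  unfolding ell2_def mem_Collect_eq
  by (rule nonneg_bdd_above_summable_on) (auto intro!: bdd_aboveI2 bessel assms)

lemma is_fourier_iff:
  "is_fourier u f \<longleftrightarrow> square_integrable f \<and>
     ((\<lambda>A. LINT x|circ. (cmod (f x - fourier_partial u A x))\<^sup>2) \<longlongrightarrow> 0) (finite_subsets_at_top UNIV)"
  by (simp add: is_fourier_def square_integrable_def)

text \<open>Once \<open>A\<close> contains \<open>n\<close>, Bessel's inequality bounds the constant
  \<open>(cmod (u n - inv_fourier f n))\<^sup>2\<close> by the mean-square error over
  \<open>A\<close>, which tends to 0.\<close>

lemma inv_fourier_is_fourier:
  assumes "is_fourier u f"
  shows "inv_fourier f = u"
proof
  fix n
  have f: "square_integrable f" using assms by (simp add: is_fourier_iff)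
  have "((\<lambda>A. (cmod (u n - inv_fourier f n))\<^sup>2) \<longlongrightarrow> 0) (finite_subsets_at_top (UNIV :: int set))"
  proof (rule Lim_null_comparison)
    show "((\<lambda>A. LINT x|circ. (cmod (f x - fourier_partial u A x))\<^sup>2) \<longlongrightarrow> 0) (finite_subsets_at_top UNIV)"
      using assms by (simp add: is_fourier_iff)
    have "\<forall>\<^sub>F A in finite_subsets_at_top UNIV. finite A \<and> {n} \<subseteq> A \<and> A \<subseteq> UNIV"
      unfolding eventually_finite_subsets_at_top by (rule exI[of _ "{n}"]) auto
    then show "\<forall>\<^sub>F A in finite_subsets_at_top UNIV. norm ((cmod (u n - inv_fourier f n))\<^sup>2)
        \<le> (LINT x|circ. (cmod (f x - fourier_partial u A x))\<^sup>2)"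
    proof eventually_elim
      case (elim A)
      then have "(cmod (u n - inv_fourier f n))\<^sup>2 \<le> (\<Sum>n\<in>A. (cmod (u n - inv_fourier f n))\<^sup>2)"
        by (intro member_le_sum) auto
      also have "\<dots> \<le> (LINT x|circ. (cmod (f x - fourier_partial u A x))\<^sup>2)"
        using bessel[OF f, of A] elim by (simp add: integral_norm_diff_fourier_partial[OF f])
      finally show ?case by simp
    qed
  qed
  then have "(cmod (u n - inv_fourier f n))\<^sup>2 = 0"
    by (simp add: tendsto_const_iff)
  then show "inv_fourier f n = u n" by simp
qed

section \<open>Riesz-Fischer theorem\<close>

lemma integral_norm_diff_fourier_partials:
  assumes "finite A" "finite B"
  shows "(LINT x|circ. (cmod (fourier_partial u A x - fourier_partial u B x))\<^sup>2)
    = (\<Sum>n\<in>(A - B) \<union> (B - A). (cmod (u n))\<^sup>2)"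
proof -
  \<comment> \<open>These coefficients are \<open>u n\<close> or \<open>- u n\<close> on the
    symmetric difference and 0 elsewhere; the sign disappears in the modulus.\<close>
  define v where "v n = (if n \<in> A then u n else 0) - (if n \<in> B then u n else 0)" for n
  have "fourier_partial u A x - fourier_partial u B x = fourier_partial v (A \<union> B) x" for x
  proof -
    let ?e = "\<lambda>n. of_real (1 / sqrt (2 * pi)) * char_circ (- n) x"
    have "fourier_partial u A x = (\<Sum>n\<in>A \<union> B. ?e n * (if n \<in> A then u n else 0))"
      unfolding fourier_partial_char_circ using assms
      by (intro sum.mono_neutral_cong_left) auto
    moreover have "fourier_partial u B x = (\<Sum>n\<in>A \<union> B. ?e n * (if n \<in> B then u n else 0))"
      unfolding fourier_partial_char_circ using assms
      by (intro sum.mono_neutral_cong_left) auto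
    ultimately show ?thesis
      unfolding fourier_partial_char_circ v_def
      by (simp only: sum_subtractf [symmetric]) (simp add: algebra_simps)
  qed
  then have "(LINT x|circ. (cmod (fourier_partial u A x - fourier_partial u B x))\<^sup>2)
      = (\<Sum>n\<in>A \<union> B. (cmod (v n))\<^sup>2)"
    using integral_norm_fourier_partial[of "A \<union> B" v] assms by simp
  also have "\<dots> = (\<Sum>n\<in>(A - B) \<union> (B - A). (cmod (u n))\<^sup>2)"
    using assms by (intro sum.mono_neutral_cong_right) (auto simp: v_def norm_minus_commute)
  finally show ?thesis .
qed

text \<open>Cauchy criterion: the sums over \<open>A \<union> B\<close> and over \<open>B\<close>
  both lie within \<open>e / 2\<close> of the total.\<close>

lemma summable_on_small_tail:
  fixes f :: "'a \<Rightarrow> real"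
  assumes "f summable_on UNIV" "e > 0"
  obtains B where "finite B" "\<And>A. finite A \<Longrightarrow> A \<inter> B = {} \<Longrightarrow> sum f A < e"
proof -
  obtain l where "(f has_sum l) UNIV" using assms by (auto simp: summable_on_def)
  then have "\<forall>\<^sub>F A in finite_subsets_at_top UNIV. dist (sum f A) l < e / 2"
    using assms(2) unfolding has_sum_def tendsto_iff by (meson half_gt_zero)
  then obtain B where B: "finite B" "\<And>A. finite A \<Longrightarrow> B \<subseteq> A \<Longrightarrow> dist (sum f A) l < e / 2"
    unfolding eventually_finite_subsets_at_top by auto
  have "sum f A < e" if A: "finite A" "A \<inter> B = {}" for A
  proof -
    have "sum f (A \<union> B) = sum f A + sum f B" using A B by (intro sum.union_disjoint) auto
    moreover have "dist (sum f (A \<union> B)) l < e / 2" "dist (sum f B) l < e / 2"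
      using A B by auto
    ultimately show ?thesis unfolding dist_real_def by linarith
  qed
  with B show ?thesis by (intro that) auto
qed

lemma nn_integral_norm_sq:
  assumes "square_integrable h"
  shows "(\<integral>\<^sup>+x. ennreal ((cmod (h x))\<^sup>2) \<partial>circ) = ennreal (LINT x|circ. (cmod (h x))\<^sup>2)"
  using assms by (intro nn_integral_eq_integral) (auto simp: square_integrable_def)

lemma square_integrable_iff_nn_integral:
  "square_integrable h \<longleftrightarrow> h \<in> borel_measurable circ \<and> (\<integral>\<^sup>+x. ennreal ((cmod (h x))\<^sup>2) \<partial>circ) < \<infinity>"
  unfolding square_integrable_def integrable_iff_bounded by auto

text \<open>Along finite sets \<open>C k\<close> whose tails decay like \<open>4 ^ - k\<close> the partial sums converge almost
  everywhere; Fatou's lemma then identifies the pointwise limit as the limit in the mean.\<close>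

lemma riesz_fischer:
  assumes "u \<in> ell2"
  shows "\<exists>f. is_fourier u f"
proof -
  have summ: "(\<lambda>n. (cmod (u n))\<^sup>2) summable_on UNIV" using assms by (simp add: ell2_def)
  have "\<exists>B. finite B \<and> (\<forall>A. finite A \<longrightarrow> A \<inter> B = {} \<longrightarrow> (\<Sum>n\<in>A. (cmod (u n))\<^sup>2) < (1 / 4) ^ k)" for k :: nat
    using summable_on_small_tail[OF summ, of "(1 / 4) ^ k"] by (metis zero_less_power zero_less_divide_1_iff zero_less_numeral)
  then obtain B where B: "\<And>k::nat. finite (B k)"
    "\<And>k A. finite A \<Longrightarrow> A \<inter> B k = {} \<Longrightarrow> (\<Sum>n\<in>A. (cmod (u n))\<^sup>2) < (1 / 4) ^ k"
    by metis
  define C where "C k = (\<Union>j\<le>k. B j)" for k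
  have C: "finite (C k)" "B k \<subseteq> C k" "k \<le> l \<Longrightarrow> C k \<subseteq> C l" for k l
    using B(1) by (auto simp: C_def intro: order_trans)
  define T where "T k = fourier_partial u (C k)" for k
  have T_sq: "square_integrable (T k)" for k
    by (simp add: T_def square_integrable_fourier_partial)
  note [measurable] = T_sq[THEN square_integrable_measurable]
  \<comment> \<open>Both index sets contain \<open>C k\<close>, so their symmetric difference avoids
    \<open>B k\<close>.\<close>
  have close: "(LINT x|circ. (cmod (T j x - fourier_partial u A x))\<^sup>2) \<le> (1 / 4) ^ k"
    if "finite A" "C k \<subseteq> A" "k \<le> j" for A j k
  proof -
    have "(LINT x|circ. (cmod (T j x - fourier_partial u A x))\<^sup>2)
        = (\<Sum>n\<in>(C j - A) \<union> (A - C j). (cmod (u n))\<^sup>2)"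
      unfolding T_def using that C by (intro integral_norm_diff_fourier_partials) auto
    also have "\<dots> < (1 / 4) ^ k"
      using that C(1)[of j] C(2)[of k] C(3)[of k j] by (intro B) auto
    finally show ?thesis by simp
  qed
  define d where "d k x = cmod (T (Suc k) x - T k x)" for k x
  have [measurable]: "d k \<in> borel_measurable circ" for k
    unfolding d_def by measurable
  have d_int: "(\<integral>\<^sup>+x. ennreal (d k x) \<partial>circ) \<le> ennreal ((1 / 2) ^ k * (2 * pi + 1))" for k
  proof -
    have sq: "square_integrable (\<lambda>x. T (Suc k) x - T k x)"
      by (intro square_integrable_diff T_sq)
    \<comment> \<open>A weighted form of 2d <= 1 + d^2 trades the mean-square bound for a bound on
      the integral of \<open>d k\<close>. It costs a factor 2^k; against the rate 4^-k of the tails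
      a summable 2^-k remains.\<close>
    have "d k x \<le> (1 / 2) ^ k + 2 ^ k * (d k x)\<^sup>2" for x
    proof -
      have "0 \<le> (2 ^ k * d k x - 1)\<^sup>2" by simp
      also have "\<dots> = 2 ^ k * (2 ^ k * (d k x)\<^sup>2 - 2 * d k x + (1 / 2) ^ k)"
        by (simp add: power2_eq_square algebra_simps power_one_over)
      finally have "0 \<le> 2 ^ k * (d k x)\<^sup>2 - 2 * d k x + (1 / 2) ^ k"
        by (rule mult_left_le_imp_le[of "2 ^ k" 0, simplified]) simp
      moreover have "0 \<le> d k x" by (simp add: d_def)
      ultimately show ?thesis by simp
    qed
    then have "(\<integral>\<^sup>+x. ennreal (d k x) \<partial>circ) \<le> (\<integral>\<^sup>+x. ennreal ((1 / 2) ^ k + 2 ^ k * (d k x)\<^sup>2) \<partial>circ)"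
      by (intro nn_integral_mono ennreal_leI)
    also have "\<dots> = ennreal (LINT x|circ. (1 / 2) ^ k + 2 ^ k * (d k x)\<^sup>2)"
      using sq by (intro nn_integral_eq_integral) (auto simp: square_integrable_def d_def)
    also have "(LINT x|circ. (1 / 2) ^ k + 2 ^ k * (d k x)\<^sup>2)
        = (1 / 2) ^ k * (2 * pi) + 2 ^ k * (LINT x|circ. (d k x)\<^sup>2)"
      using sq by (simp add: square_integrable_def d_def measure_restrict_space)
    also have "(LINT x|circ. (d k x)\<^sup>2) \<le> (1 / 4) ^ k"
      using close[of "C k" k "Suc k"] C unfolding d_def T_def by auto
    also have "(1 / 2) ^ k * (2 * pi) + 2 ^ k * (1 / 4) ^ k = (1 / 2) ^ k * (2 * pi + 1 :: real)"
      by (simp add: algebra_simps flip: power_mult_distrib)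
    finally show ?thesis by (simp add: ennreal_leI)
  qed
  have "(\<integral>\<^sup>+x. (\<Sum>k. ennreal (d k x)) \<partial>circ) = (\<Sum>k. \<integral>\<^sup>+x. ennreal (d k x) \<partial>circ)"
    by (rule nn_integral_suminf) measurable
  also have "\<dots> \<le> (\<Sum>k. ennreal ((1 / 2) ^ k * (2 * pi + 1)))"
    by (intro suminf_le d_int) auto
  also have "\<dots> = ennreal (\<Sum>k. (1 / 2) ^ k * (2 * pi + 1))"
    by (intro suminf_ennreal2 summable_mult2) auto
  finally have "(\<integral>\<^sup>+x. (\<Sum>k. ennreal (d k x)) \<partial>circ) \<noteq> \<infinity>"
    by (auto simp: top_unique)
  then have "AE x in circ. (\<Sum>k. ennreal (d k x)) \<noteq> \<infinity>"
    by (intro nn_integral_PInf_AE) auto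
  then have AE_conv: "AE x in circ. convergent (\<lambda>k. T k x)"
  proof eventually_elim
    case (elim x)
    have "summable (\<lambda>k. d k x)"
      using elim by (intro summable_suminf_not_top) (auto simp: d_def)
    then have "summable (\<lambda>k. T (Suc k) x - T k x)"
      unfolding d_def by (rule summable_norm_cancel)
    moreover have "(\<Sum>i<n. T (Suc i) x - T i x) = T n x - T 0 x" for n
      using sum_lessThan_telescope[of "\<lambda>i. T i x" n] .
    ultimately have "convergent (\<lambda>n. T n x - T 0 x)"
      by (simp add: summable_iff_convergent)
    then show ?case by (simp add: convergent_diff_const_right_iff)
  qed
  \<comment> \<open>Where the sequence diverges this value is arbitrary, which concerns a null set
    only.\<close>
  define f where "f x = lim (\<lambda>k. T k x)" for x
  have [measurable]: "f \<in> borel_measurable circ"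
    unfolding f_def by measurable
  \<comment> \<open>Allowing every finite \<open>A\<close> that contains \<open>C k\<close>, and not
    just \<open>C k\<close> itself, is what turns convergence along a sequence into the unordered
    limit.\<close>
  have fatou: "(\<integral>\<^sup>+x. ennreal ((cmod (f x - fourier_partial u A x))\<^sup>2) \<partial>circ) \<le> ennreal ((1 / 4) ^ k)"
    if A: "finite A" "C k \<subseteq> A" for A k
  proof -
    note [measurable] = square_integrable_fourier_partial[THEN square_integrable_measurable]
    have "(\<integral>\<^sup>+x. ennreal ((cmod (f x - fourier_partial u A x))\<^sup>2) \<partial>circ)
        = (\<integral>\<^sup>+x. liminf (\<lambda>j. ennreal ((cmod (T j x - fourier_partial u A x))\<^sup>2)) \<partial>circ)"
    proof (rule nn_integral_cong_AE, use AE_conv in eventually_elim)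
      case (elim x)
      then have "(\<lambda>j. T j x) \<longlonglongrightarrow> f x" by (simp add: f_def convergent_LIMSEQ_iff)
      then have "(\<lambda>j. ennreal ((cmod (T j x - fourier_partial u A x))\<^sup>2))
          \<longlonglongrightarrow> ennreal ((cmod (f x - fourier_partial u A x))\<^sup>2)"
        by (intro tendsto_intros)
      then show ?case by (intro lim_imp_Liminf [symmetric]) auto
    qed
    also have "\<dots> \<le> liminf (\<lambda>j. \<integral>\<^sup>+x. ennreal ((cmod (T j x - fourier_partial u A x))\<^sup>2) \<partial>circ)"
      by (rule nn_integral_liminf) measurable
    also have "\<dots> \<le> limsup (\<lambda>j. \<integral>\<^sup>+x. ennreal ((cmod (T j x - fourier_partial u A x))\<^sup>2) \<partial>circ)"
      by (rule Liminf_le_Limsup) simp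
    also have "\<dots> \<le> ennreal ((1 / 4) ^ k)"
    proof (rule Limsup_bounded, rule eventually_mono[OF eventually_ge_at_top[of k]])
      fix j assume "k \<le> j"
      have "square_integrable (\<lambda>x. T j x - fourier_partial u A x)"
        by (intro square_integrable_diff T_sq square_integrable_fourier_partial)
      then show "(\<integral>\<^sup>+x. ennreal ((cmod (T j x - fourier_partial u A x))\<^sup>2) \<partial>circ) \<le> ennreal ((1 / 4) ^ k)"
        using close[OF A \<open>k \<le> j\<close>] by (simp only: nn_integral_norm_sq ennreal_leI)
    qed
    finally show ?thesis .
  qed
  have diff: "square_integrable (\<lambda>x. f x - fourier_partial u A x)" if "finite A" "C k \<subseteq> A" for A k
    using fatou[OF that] square_integrable_fourier_partial[THEN square_integrable_measurable]
    by (auto simp: square_integrable_iff_nn_integral intro: le_less_trans)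
  \<comment> \<open>Write \<open>f\<close> as its difference from a partial sum, of finite norm by
    Fatou, plus that partial sum.\<close>
  have "square_integrable f"
    using square_integrable_add[OF diff[of "C 0" 0] square_integrable_fourier_partial[of u "C 0"]] C(1)
    by simp
  moreover have "((\<lambda>A. LINT x|circ. (cmod (f x - fourier_partial u A x))\<^sup>2) \<longlongrightarrow> 0) (finite_subsets_at_top UNIV)"
  proof (rule tendstoI)
    fix e :: real assume "e > 0"
    obtain k where k: "(1 / 4) ^ k < e" using real_arch_pow_inv[OF \<open>e > 0\<close>, of "1 / 4"] by auto
    have "(LINT x|circ. (cmod (f x - fourier_partial u A x))\<^sup>2) < e" if "finite A" "C k \<subseteq> A" for A
      using fatou[OF that] k nn_integral_norm_sq[OF diff[OF that]] by (simp add: ennreal_le_iff)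
    then show "\<forall>\<^sub>F A in finite_subsets_at_top UNIV.
        dist (LINT x|circ. (cmod (f x - fourier_partial u A x))\<^sup>2) 0 < e"
      unfolding eventually_finite_subsets_at_top using C(1) by (intro exI[of _ "C k"]) auto
  qed
  ultimately show ?thesis unfolding is_fourier_iff by blast
qed

lemma is_fourier_fourier:
  "u \<in> ell2 \<Longrightarrow> is_fourier u (fourier u)"
  unfolding fourier_def by (rule someI_ex[OF riesz_fischer])

section \<open>Completeness and Parseval's identity\<close>

text \<open>Completeness of the characters says that this class contains only null
  functions.\<close>

definition zero_coeffs :: "(real \<Rightarrow> complex) \<Rightarrow> bool" where
  "zero_coeffs h \<longleftrightarrow> integrable circ h \<and> (\<forall>n. (LINT x|circ. h x * char_circ n x) = 0)"

lemma zero_coeffs_add: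
  assumes "zero_coeffs f" "zero_coeffs g"
  shows "zero_coeffs (\<lambda>x. f x + g x)"
  using assms integrable_mult_char_circ[of f] integrable_mult_char_circ[of g]
  by (simp add: zero_coeffs_def distrib_right)

lemma zero_coeffs_cmult:
  assumes "zero_coeffs f"
  shows "zero_coeffs (\<lambda>x. f x * c)"
proof -
  have "(\<lambda>x. f x * c * char_circ n x) = (\<lambda>x. c * (f x * char_circ n x))" for n
    by (simp add: mult_ac)
  then show ?thesis using assms by (simp add: zero_coeffs_def)
qed

lemma zero_coeffs_char_circ:
  "zero_coeffs f \<Longrightarrow> zero_coeffs (\<lambda>x. f x * char_circ m x)"
  by (simp add: zero_coeffs_def integrable_mult_char_circ mult.assoc flip: char_circ_add)

text \<open>Polynomials on the unit circle are trigonometric polynomials, and the class is closed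
  under sums, scalars and multiplication by characters. Generalising over \<open>h\<close> serves
  the product case, where the hypothesis for \<open>q\<close> is applied to \<open>h\<close> times
  \<open>p\<close>.\<close>

lemma zero_coeffs_polynomial:
  fixes p :: "complex \<Rightarrow> real"
  assumes "real_polynomial_function p" "zero_coeffs h"
  shows "zero_coeffs (\<lambda>x. h x * of_real (p (cis x)))"
  using assms
proof (induction arbitrary: h rule: real_polynomial_function.induct)
  case (linear p)
  interpret bounded_linear p by fact
  have "p (cis x) = p (cos x *\<^sub>R 1 + sin x *\<^sub>R \<i>)" for x
    by (rule arg_cong[of _ _ p]) (simp add: complex_eq_iff)
  then have p: "p (cis x) = cos x * p 1 + sin x * p \<i>" for x
    by (simp add: add scaleR)
  \<comment> \<open>Euler's formulas for cosine and sine give these two coefficients.\<close>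
  let ?a = "(of_real (p 1) - \<i> * of_real (p \<i>)) / 2"
  let ?b = "(of_real (p 1) + \<i> * of_real (p \<i>)) / 2"
  have "of_real (p (cis x)) = char_circ 1 x * ?a + char_circ (- 1) x * ?b" for x
    by (simp add: p char_circ_cis complex_eq_iff field_simps)
  then have "(\<lambda>x. h x * of_real (p (cis x))) =
      (\<lambda>x. h x * char_circ 1 x * ?a + h x * char_circ (- 1) x * ?b)"
    by (simp only: distrib_left mult.assoc)
  then show ?case
    using linear.prems by (simp only: zero_coeffs_add zero_coeffs_cmult zero_coeffs_char_circ)
next
  case (const c)
  then show ?case by (rule zero_coeffs_cmult)
next
  case (add p q)
  then show ?case by (simp add: distrib_left zero_coeffs_add)
next
  case (mult p q)
  then show ?case by (simp flip: mult.assoc)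
qed

lemma integrable_mult_cis:
  fixes h :: "real \<Rightarrow> complex"
  assumes h: "integrable circ h" and p: "continuous_on UNIV (p :: complex \<Rightarrow> real)"
  shows "integrable circ (\<lambda>x. h x * of_real (p (cis x)))"
proof -
  have [measurable]: "h \<in> borel_measurable circ" using h by auto
  have [measurable]: "(\<lambda>x. p (cis x)) \<in> borel_measurable circ"
    by (intro measurable_circ_borel borel_measurable_continuous_onI
        continuous_on_compose2[OF p] continuous_intros) auto
  have "compact (p ` sphere 0 1)"
    by (intro compact_continuous_image continuous_on_subset[OF p]) auto
  then obtain C where "\<forall>z\<in>sphere 0 1. \<bar>p z\<bar> \<le> C"
    using compact_imp_bounded[of "p ` sphere 0 1"] unfolding bounded_iff by auto
  then have "\<bar>p (cis x)\<bar> \<le> C" for x by simp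
  then have C: "cmod (h x * of_real (p (cis x))) \<le> norm (C * cmod (h x))" for x
    using mult_right_mono[of "\<bar>p (cis x)\<bar>" "\<bar>C\<bar>" "cmod (h x)"]
    by (simp add: norm_mult abs_mult mult.commute) (smt (verit))
  have "integrable circ (\<lambda>x. C * cmod (h x))" using h by simp
  then show ?thesis
    by (rule Bochner_Integration.integrable_bound) (measurable, rule AE_I2, rule C)
qed

text \<open>By Stone-Weierstrass \<open>p\<close> is within \<open>e\<close> of a polynomial on the
  unit circle. The integral against the polynomial is a zeroth coefficient and vanishes; the
  replacement costs at most \<open>e\<close> times the L1 norm of \<open>h\<close>.\<close>

lemma zero_coeffs_continuous:
  assumes h: "zero_coeffs h" and c: "continuous_on UNIV (p :: complex \<Rightarrow> real)"
  shows "(LINT x|circ. h x * of_real (p (cis x))) = 0"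
proof -
  define I where "I = (LINT x|circ. cmod (h x))"
  have int: "integrable circ h" using h by (simp add: zero_coeffs_def)
  have bound: "cmod (LINT x|circ. h x * of_real (p (cis x))) \<le> e * I" if e: "e > 0" for e
  proof -
    obtain q where q: "real_polynomial_function q" "\<And>z. z \<in> sphere 0 1 \<Longrightarrow> \<bar>p z - q z\<bar> < e"
      by (rule Stone_Weierstrass_real_polynomial_function[OF compact_sphere[of 0 1] continuous_on_subset[OF c subset_UNIV] e])
        (rule that)
    have cq: "continuous_on UNIV q"
      using q(1) continuous_on_polymonial_function real_polynomial_function_eq by blast
    have "(LINT x|circ. h x * of_real (q (cis x))) = 0"
      using zero_coeffs_polynomial[OF q(1) h] unfolding zero_coeffs_def
      by (metis (no_types, lifting) Bochner_Integration.integral_cong char_circ_0 mult.right_neutral)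
    then have "(LINT x|circ. h x * of_real (p (cis x)))
        = (LINT x|circ. h x * of_real (p (cis x)) - h x * of_real (q (cis x)))"
      using integrable_mult_cis[OF int c] integrable_mult_cis[OF int cq] by simp
    also have "cmod \<dots> \<le> (LINT x|circ. cmod (h x * of_real (p (cis x)) - h x * of_real (q (cis x))))"
      by simp
    also have "\<dots> \<le> (LINT x|circ. e * cmod (h x))"
    proof (rule integral_mono)
      fix x
      have "cmod (h x * of_real (p (cis x)) - h x * of_real (q (cis x))) = cmod (h x) * \<bar>p (cis x) - q (cis x)\<bar>"
        by (simp add: norm_mult flip: right_diff_distrib of_real_diff)
      also have "\<dots> \<le> cmod (h x) * e"
        using q(2)[of "cis x"] by (intro mult_left_mono) auto
      finally show "cmod (h x * of_real (p (cis x)) - h x * of_real (q (cis x))) \<le> e * cmod (h x)"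
        by (simp add: mult.commute)
    qed (intro integrable_norm Bochner_Integration.integrable_diff integrable_mult_right
        integrable_mult_cis int c cq)+
    finally show ?thesis by (simp add: I_def)
  qed
  have "I \<ge> 0" by (simp add: I_def)
  have "cmod (LINT x|circ. h x * of_real (p (cis x))) \<le> e" if "e > 0" for e
  proof -
    \<comment> \<open>Dividing by \<open>I + 1\<close> instead of \<open>I\<close> also covers
      \<open>I = 0\<close>.\<close>
    have "cmod (LINT x|circ. h x * of_real (p (cis x))) \<le> e / (I + 1) * I"
      using that \<open>I \<ge> 0\<close> by (intro bound) auto
    also have "\<dots> \<le> e" using that \<open>I \<ge> 0\<close> by (simp add: field_simps)
    finally show ?thesis .
  qed
  then have "cmod (LINT x|circ. h x * of_real (p (cis x))) \<le> 0"
    by (rule field_le_epsilon) simp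
  then show ?thesis by simp
qed

section \<open>Completeness: from continuous functions to measurable sets\<close>

lemma cos_less_iff_on_arc:
  assumes "0 \<le> r" "r \<le> pi" "\<bar>y\<bar> < 2 * pi - r"
  shows "cos r < cos y \<longleftrightarrow> \<bar>y\<bar> < r"
proof (cases "\<bar>y\<bar> \<le> pi")
  case True
  then show ?thesis using cos_mono_less_eq[of r "\<bar>y\<bar>"] assms by simp
next
  case False
  \<comment> \<open>Reflection brings \<open>y\<close> back to the range where cosine decreases,
    still beyond \<open>r\<close>. Such \<open>y\<close> do occur: a point may be farther than pi
    from the midpoint of an interval inside (-pi, pi).\<close>
  have "cos y = cos (2 * pi - \<bar>y\<bar>)" by (simp add: cos_diff)
  moreover have "\<not> cos r < cos (2 * pi - \<bar>y\<bar>)"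
    using cos_mono_less_eq[of r "2 * pi - \<bar>y\<bar>"] assms False by simp
  ultimately show ?thesis using assms False by simp
qed

text \<open>The interval is an arc of the circle, cut out by the positivity of the continuous function
  \<open>\<lambda>z. Re (z * cis (- s)) - cos r\<close>.\<close>

lemma zero_coeffs_interval:
  assumes h: "zero_coeffs h" and ab: "-pi \<le> a" "b \<le> pi"
  shows "(LINT x|circ. indicator {a<..<b} x *\<^sub>R h x) = 0"
proof (cases "a < b")
  case True
  define s r where "s = (a + b) / 2" and "r = (b - a) / 2"
  have int: "integrable circ h" using h by (simp add: zero_coeffs_def)
  then have [measurable]: "h \<in> borel_measurable circ" by auto
  \<comment> \<open>Continuous functions on the circle that increase with \<open>k\<close> to the
    indicator of the arc; the cap at 1 provides the dominating function.\<close>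
  define p where "p k z = min 1 (real k * max 0 (Re (z * cis (- s)) - cos r))" for k z
  have cont: "continuous_on UNIV (p k)" for k
    unfolding p_def by (intro continuous_intros)
  have "(\<lambda>k. LINT x|circ. h x * of_real (p k (cis x))) \<longlonglongrightarrow> (LINT x|circ. indicator {a<..<b} x *\<^sub>R h x)"
  proof (rule integral_dominated_convergence[where w = "\<lambda>x. cmod (h x)"])
    show "AE x in circ. (\<lambda>k. h x * of_real (p k (cis x))) \<longlonglongrightarrow> indicator {a<..<b} x *\<^sub>R h x"
    proof (rule AE_I2)
      fix x assume "x \<in> space circ"
      then have x: "-pi < x" "x < pi" by auto
      have pk: "p k (cis x) = min 1 (real k * max 0 (cos (x - s) - cos r))" for k
        by (simp add: p_def cos_diff)
      have iff: "cos r < cos (x - s) \<longleftrightarrow> x \<in> {a<..<b}"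
        using cos_less_iff_on_arc[of r "x - s"] x ab True unfolding r_def s_def
        by (auto simp: abs_less_iff field_simps)
      have "(\<lambda>k. p k (cis x)) \<longlonglongrightarrow> indicator {a<..<b} x"
      proof (cases "x \<in> {a<..<b}")
        case True
        define d where "d = cos (x - s) - cos r"
        have "d > 0" using True iff by (simp add: d_def)
        then obtain N :: nat where N: "1 < real N * d" using reals_Archimedean3 by blast
        have "p k (cis x) = 1" if "N \<le> k" for k
        proof -
          have "real N * d \<le> real k * d" using that \<open>d > 0\<close> by (intro mult_right_mono) auto
          then have "1 \<le> real k * d" using N by linarith
          then show ?thesis using \<open>d > 0\<close> by (simp add: pk flip: d_def)
        qed
        then show ?thesis using True
          by (intro tendsto_eventually) (auto simp: eventually_sequentially)
      next
        case False
        then have "cos (x - s) - cos r \<le> 0" using iff by auto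
        then show ?thesis using False by (simp add: pk max_absorb1 del: greaterThanLessThan_iff)
      qed
      then have "(\<lambda>k. h x * of_real (p k (cis x))) \<longlonglongrightarrow> h x * of_real (indicator {a<..<b} x)"
        by (intro tendsto_intros)
      then show "(\<lambda>k. h x * of_real (p k (cis x))) \<longlonglongrightarrow> indicator {a<..<b} x *\<^sub>R h x"
        by (simp add: scaleR_conv_of_real mult.commute)
    qed
    show "AE x in circ. norm (h x * of_real (p k (cis x))) \<le> cmod (h x)" for k
      by (intro AE_I2) (auto simp: norm_mult p_def mult_left_le)
    show "(\<lambda>x. h x * of_real (p k (cis x))) \<in> borel_measurable circ" for k
      using integrable_mult_cis[OF int cont] by (rule borel_measurable_integrable)
    show "integrable circ (\<lambda>x. cmod (h x))" using int by simp
  qed measurable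
  then show ?thesis
    by (simp add: zero_coeffs_continuous[OF h cont] LIMSEQ_const_iff)
qed simp

text \<open>A function whose integral over every measurable set vanishes is null. Open intervals
  form an intersection-stable generator, so Dynkin's argument passes from them to Borel sets; a
  Lebesgue set differs from a Borel set only inside a null set.\<close>

lemma zero_coeffs_imp_AE_zero:
  assumes h: "zero_coeffs h"
  shows "AE x in circ. h x = 0"
proof (rule circ.density_zero)
  show int: "integrable circ h" using h by (simp add: zero_coeffs_def)
  then have [measurable]: "h \<in> borel_measurable circ" by auto
  have [measurable]: "(\<lambda>x. indicator S x :: real) \<in> borel_measurable circ" if "S \<in> sets borel" for S :: "real set"
    using that by (intro measurable_circ_borel borel_measurable_indicator)
  have eq: "borel = sigma UNIV (range (\<lambda>(a, b). {a<..<b::real}))"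
    using borel_eq_box[where 'a = real] by (simp add: box_real)
  have int_ind: "integrable circ (\<lambda>x. indicator S x *\<^sub>R h x)" if "S \<in> sets borel" for S
    using that by (intro Bochner_Integration.integrable_bound[OF int]) (auto simp: indicator_def)
  have borel: "(LINT x|circ. indicator S x *\<^sub>R h x) = 0" if "S \<in> sets borel" for S
  proof -
    have sigma: "S \<in> sigma_sets UNIV (range (\<lambda>(a, b). {a<..<b::real}))"
      using that by (simp add: eq)
    have "Int_stable (range (\<lambda>(a, b). {a<..<b::real}))"
      by (auto simp: Int_stable_def)
    moreover have "range (\<lambda>(a, b). {a<..<b::real}) \<subseteq> Pow UNIV" by simp
    ultimately show ?thesis
      using sigma
    proof (induction rule: sigma_sets_induct_disjoint)
      case (basic A)
      then obtain a b where A: "A = {a<..<b}" by auto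
      have "(LINT x|circ. indicator A x *\<^sub>R h x) = (LINT x|circ. indicator {max a (-pi)<..<min b pi} x *\<^sub>R h x)"
        by (intro Bochner_Integration.integral_cong) (auto simp: A indicator_def)
      then show ?case by (simp add: zero_coeffs_interval[OF h])
    next
      case (compl A)
      then have "A \<in> sets borel" by (simp add: eq)
      have "(LINT x|circ. indicator (UNIV - A) x *\<^sub>R h x) = (LINT x|circ. h x - indicator A x *\<^sub>R h x)"
        by (intro Bochner_Integration.integral_cong) (auto simp: indicator_def)
      also have "\<dots> = (LINT x|circ. h x)"
        using int int_ind[OF \<open>A \<in> sets borel\<close>] compl by simp
      \<comment> \<open>The integral over the whole space is the coefficient at index 0.\<close>
      also have "\<dots> = 0"
        using h unfolding zero_coeffs_def by (auto dest: spec[of _ 0])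
      finally show ?case .
    next
      case (union A)
      then have A: "A i \<in> sets borel" for i by (auto simp: eq)
      have "((\<lambda>n. LINT x|circ. indicator (\<Union>i<n. A i) x *\<^sub>R h x) \<longlonglongrightarrow> (LINT x|circ. indicator (\<Union>i. A i) x *\<^sub>R h x))"
      proof (rule integral_dominated_convergence[where w = "\<lambda>x. cmod (h x)"])
        show "AE x in circ. (\<lambda>n. indicator (\<Union>i<n. A i) x *\<^sub>R h x) \<longlonglongrightarrow> indicator (\<Union>i. A i) x *\<^sub>R h x"
          by (intro AE_I2 tendsto_intros LIMSEQ_indicator_UN)
        show "(\<lambda>x. indicator (\<Union>i<n. A i) x *\<^sub>R h x) \<in> borel_measurable circ" for n
          by (intro borel_measurable_integrable int_ind sets.countable_UN'' A) auto
        show "(\<lambda>x. indicator (\<Union>i. A i) x *\<^sub>R h x) \<in> borel_measurable circ"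
          by (intro borel_measurable_integrable int_ind sets.countable_UN'' A) auto
        show "integrable circ (\<lambda>x. cmod (h x))" using int by simp
        show "AE x in circ. norm (indicator (\<Union>i<n. A i) x *\<^sub>R h x) \<le> cmod (h x)" for n
          by (intro AE_I2) (simp add: indicator_def)
      qed
      moreover have "(LINT x|circ. indicator (\<Union>i<n. A i) x *\<^sub>R h x) = 0" for n
      proof -
        have "indicator (\<Union>i<n. A i) x *\<^sub>R h x = (\<Sum>i<n. indicator (A i) x *\<^sub>R h x)" for x
          using union(1) by (subst indicator_UN_disjoint) 
            (auto simp: disjoint_family_on_def scaleR_sum_left)
        then have "(LINT x|circ. indicator (\<Union>i<n. A i) x *\<^sub>R h x)
            = (\<Sum>i<n. LINT x|circ. indicator (A i) x *\<^sub>R h x)"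
          using int_ind[OF A] by (simp only: Bochner_Integration.integral_sum)
        then show ?thesis using union by simp
      qed
      ultimately show ?case by (simp add: LIMSEQ_const_iff)
    qed auto
  qed
  fix A assume "A \<in> sets circ"
  then have "A \<in> sets lebesgue" by (auto simp: sets_restrict_space)
  then obtain S N N' where S: "A = S \<union> N" "N \<subseteq> N'" "N' \<in> null_sets lborel" "S \<in> sets lborel"
    by (rule sets_completionE)
  have "N' \<in> null_sets lebesgue" using S by (simp add: null_sets_completion_subset null_sets_completionI)
  then have "AE x in lebesgue. x \<notin> N'" by (rule AE_not_in)
  then have "AE x in circ. x \<notin> N'" by (auto simp: AE_restrict_space_iff)
  then have "AE x in circ. indicator A x *\<^sub>R h x = indicator S x *\<^sub>R h x"
    by eventually_elim (use S in \<open>auto simp: indicator_def\<close>)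
  then have "(LINT x|circ. indicator A x *\<^sub>R h x) = (LINT x|circ. indicator S x *\<^sub>R h x)"
    using S(4) \<open>A \<in> sets circ\<close> by (intro integral_cong_AE) auto
  then show "set_lebesgue_integral circ A h = 0"
    using borel S(4) by (simp add: set_lebesgue_integral_def)
qed

text \<open>Riesz-Fischer supplies an \<open>f\<close> that is the mean-square limit of the series
  of \<open>h\<close>. The difference of \<open>h\<close> and \<open>f\<close> has zero
  coefficients, so by completeness the series converges to \<open>h\<close> itself, and the
  expansion identity turns the vanishing error into the sum of squares.\<close>

lemma parseval:
  assumes h: "square_integrable h"
  shows "sq_sum (inv_fourier h) = (\<integral>\<^sup>+x. ennreal ((cmod (h x))\<^sup>2) \<partial>circ)"
proof -
  let ?u = "inv_fourier h"
  obtain f where f: "is_fourier ?u f" using riesz_fischer[OF inv_fourier_ell2[OF h]] by blast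
  have f2: "square_integrable f" using f by (simp add: is_fourier_iff)
  note int = h[THEN square_integrable_imp_integrable] f2[THEN square_integrable_imp_integrable]
  have "zero_coeffs (\<lambda>x. h x - f x)"
    unfolding zero_coeffs_def
  proof (intro conjI allI)
    fix n
    have "inv_fourier (\<lambda>x. h x - f x) n = 0"
      by (subst inv_fourier_diff[OF int]) (simp add: inv_fourier_is_fourier[OF f])
    then show "(LINT x|circ. (h x - f x) * char_circ n x) = 0"
      by (simp add: inv_fourier_char_circ)
  qed (use int in auto)
  then have "AE x in circ. h x - f x = 0" by (rule zero_coeffs_imp_AE_zero)
  then have hf: "(LINT x|circ. (cmod (h x - fourier_partial ?u A x))\<^sup>2)
      = (LINT x|circ. (cmod (f x - fourier_partial ?u A x))\<^sup>2)" for A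
    using h f2 square_integrable_fourier_partial[THEN square_integrable_measurable, of ?u A]
    by (intro integral_cong_AE) (auto dest!: square_integrable_measurable elim: eventually_mono)
  define L where "L = (LINT x|circ. (cmod (h x))\<^sup>2)"
  have "((\<lambda>A. L - (LINT x|circ. (cmod (h x - fourier_partial ?u A x))\<^sup>2)) \<longlongrightarrow> L - 0) (finite_subsets_at_top UNIV)"
    unfolding hf using f by (intro tendsto_intros) (simp add: is_fourier_iff)
  then have "((\<lambda>A. L - (LINT x|circ. (cmod (h x - fourier_partial ?u A x))\<^sup>2)) \<longlongrightarrow> L) (finite_subsets_at_top UNIV)"
    by simp
  then have "((\<lambda>A. \<Sum>n\<in>A. (cmod (?u n))\<^sup>2) \<longlongrightarrow> L) (finite_subsets_at_top UNIV)"
  proof (rule Lim_transform_eventually[OF _ eventually_finite_subsets_at_top_weakI])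
    fix A :: "int set" assume "finite A"
    then show "L - (LINT x|circ. (cmod (h x - fourier_partial ?u A x))\<^sup>2) = (\<Sum>n\<in>A. (cmod (?u n))\<^sup>2)"
      by (simp add: L_def integral_norm_diff_fourier_partial[OF h])
  qed
  then have "((\<lambda>A. ennreal (\<Sum>n\<in>A. (cmod (?u n))\<^sup>2)) \<longlongrightarrow> ennreal L) (finite_subsets_at_top UNIV)"
    by (intro tendsto_ennrealI) simp
  then have "((\<lambda>A. \<Sum>n\<in>A. ennreal ((cmod (?u n))\<^sup>2)) \<longlongrightarrow> ennreal L) (finite_subsets_at_top UNIV)"
    by (subst sum_ennreal) auto
  then have "((\<lambda>n. ennreal ((cmod (?u n))\<^sup>2)) has_sum ennreal L) UNIV"
    unfolding has_sum_def .
  then show ?thesis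
    unfolding sq_sum_def nn_integral_norm_sq[OF h] L_def by (rule infsumI)
qed

section \<open>Pointwise description of the rearrangement\<close>

text \<open>The distribution function of the modulus of \<open>f\<close>.\<close>

definition circ_dist :: "(real \<Rightarrow> complex) \<Rightarrow> real \<Rightarrow> real" where
  "circ_dist f t = measure circ {x \<in> space circ. t < cmod (f x)}"

context
  fixes f :: "real \<Rightarrow> complex"
  assumes f [measurable]: "f \<in> borel_measurable circ"
begin

lemma circ_level_sets: "{x. - pi < x \<and> x < pi \<and> t < cmod (f x)} \<in> sets circ"
proof -
  have "{x \<in> space circ. t < cmod (f x)} \<in> sets circ" by measurable
  then show ?thesis by simp
qed

lemma circ_dist_antimono: "s \<le> t \<Longrightarrow> circ_dist f t \<le> circ_dist f s"
  unfolding circ_dist_def by (intro circ.finite_measure_mono) (auto simp: circ_level_sets)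

lemma circ_dist_measurable [measurable]: "circ_dist f \<in> borel_measurable borel"
proof -
  have "mono (\<lambda>t. - circ_dist f t)" by (intro monoI) (simp add: circ_dist_antimono)
  then have "(\<lambda>t. - (- circ_dist f t)) \<in> borel_measurable borel"
    by (intro borel_measurable_uminus borel_measurable_mono)
  then show ?thesis by simp
qed

text \<open>Right continuity in the form needed for strict inequalities: the level set at
  \<open>s\<close> is the increasing union of those at \<open>s + 1 / (n + 1)\<close>.\<close>

lemma circ_dist_right_cont:
  assumes "c < circ_dist f s"
  obtains t where "s < t" "c < circ_dist f t"
proof -
  let ?A = "\<lambda>n. {x \<in> space circ. s + 1 / real (Suc n) < cmod (f x)}"
  have "(\<lambda>n. measure circ (?A n)) \<longlonglongrightarrow> measure circ (\<Union>n. ?A n)"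
  proof (rule circ.finite_Lim_measure_incseq)
    show "incseq ?A"
    proof (rule incseq_SucI, safe)
      fix n x assume "s + 1 / real (Suc n) < cmod (f x)"
      moreover have "1 / real (Suc (Suc n)) \<le> 1 / real (Suc n)" by (simp add: field_simps)
      ultimately show "s + 1 / real (Suc (Suc n)) < cmod (f x)" by linarith
    qed
  qed (auto simp: circ_level_sets)
  also have "(\<Union>n. ?A n) = {x \<in> space circ. s < cmod (f x)}"
  proof (intro equalityI subsetI)
    fix x assume "x \<in> {x \<in> space circ. s < cmod (f x)}"
    moreover from this obtain n where "inverse (real (Suc n)) < cmod (f x) - s"
      using reals_Archimedean[of "cmod (f x) - s"] by auto
    ultimately have "x \<in> ?A n" by (simp add: field_simps inverse_eq_divide)
    then show "x \<in> (\<Union>n. ?A n)" by blast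
  next
    fix x assume "x \<in> (\<Union>n. ?A n)"
    then obtain n where "x \<in> space circ" "s + 1 / real (Suc n) < cmod (f x)" by blast
    moreover have "0 < 1 / real (Suc n)" by simp
    ultimately show "x \<in> {x \<in> space circ. s < cmod (f x)}"
      unfolding mem_Collect_eq by linarith
  qed
  finally have "(\<lambda>n. circ_dist f (s + 1 / real (Suc n))) \<longlonglongrightarrow> circ_dist f s"
    by (simp add: circ_dist_def)
  then have "\<forall>\<^sub>F n in sequentially. c < circ_dist f (s + 1 / real (Suc n))"
    using assms by (rule order_tendstoD)
  then obtain n where "c < circ_dist f (s + 1 / real (Suc n))"
    by (auto simp: eventually_sequentially)
  then show ?thesis by (intro that[of "s + 1 / real (Suc n)"]) auto
qed

text \<open>The level sets decrease to the empty set inside a space of finite measure. This bounds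
  the levels that count at a point other than 0.\<close>

lemma circ_dist_vanishes:
  assumes "0 < c"
  obtains N where "circ_dist f N < c"
proof -
  let ?A = "\<lambda>n. {x \<in> space circ. real n < cmod (f x)}"
  have "(\<lambda>n. measure circ (?A n)) \<longlonglongrightarrow> measure circ (\<Inter>n. ?A n)"
    by (rule circ.finite_Lim_measure_decseq) (auto simp: decseq_def circ_level_sets)
  also have "(\<Inter>n. ?A n) = {}"
    using reals_Archimedean2 less_asym by (auto, blast)
  finally have "(\<lambda>n. circ_dist f (real n)) \<longlonglongrightarrow> 0" by (simp add: circ_dist_def)
  then have "\<forall>\<^sub>F n in sequentially. circ_dist f (real n) < c"
    using assms by (rule order_tendstoD)
  then show ?thesis using that by (auto simp: eventually_sequentially)
qed

text \<open>At positive levels the zero extension adds no points, and \<open>x\<close> lies in the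
  centred interval of length L exactly when 2|x| < L. The layer integral thus measures a set of
  levels.\<close>

lemma circ_rearr_eq_measure:
  "circ_rearr f x = measure lborel {t. 0 < t \<and> 2 * \<bar>x\<bar> < circ_dist f t}"
proof -
  have dist: "measure lebesgue {y. t < cmod (extend_zero f y)} = circ_dist f t" if "0 < t" for t
  proof -
    have "{y. t < cmod (extend_zero f y)} = {x \<in> space circ. t < cmod (f x)}"
      using that by (auto simp: extend_zero_def)
    then show ?thesis by (simp add: circ_dist_def measure_restrict_space subset_eq)
  qed
  have "indicator {0<..} t *\<^sub>R indicat_real (set_rearr {y. t < cmod (extend_zero f y)}) x
      = indicat_real {t. 0 < t \<and> 2 * \<bar>x\<bar> < circ_dist f t} t" for t
    by (cases "0 < t") (simp_all add: indicator_def set_rearr_def dist abs_less_iff, linarith)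
  then have "circ_rearr f x = (LINT t|lborel. indicat_real {t. 0 < t \<and> 2 * \<bar>x\<bar> < circ_dist f t} t)"
    unfolding circ_rearr_def sym_decr_rearr_def set_lebesgue_integral_def by simp
  then show ?thesis by simp
qed

lemma circ_rearr_nonneg: "0 \<le> circ_rearr f x"
  by (simp add: circ_rearr_eq_measure)

text \<open>The levels counted at \<open>x\<close> form an initial segment because
  \<open>circ_dist f\<close> decreases. Right continuity gives room above \<open>s\<close>, making
  its length strictly larger. For \<open>x \<noteq> 0\<close> the segment is bounded, so
  \<open>measure\<close> does not fall back to 0 on an infinite length.\<close>

lemma less_circ_rearr_iff:
  assumes "x \<noteq> 0" "0 \<le> s"
  shows "s < circ_rearr f x \<longleftrightarrow> 2 * \<bar>x\<bar> < circ_dist f s"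
proof
  let ?P = "{t. 0 < t \<and> 2 * \<bar>x\<bar> < circ_dist f t}"
  have [measurable]: "?P \<in> sets lborel" by measurable
  show "2 * \<bar>x\<bar> < circ_dist f s" if "s < circ_rearr f x"
  proof (rule ccontr)
    assume "\<not> 2 * \<bar>x\<bar> < circ_dist f s"
    then have "t \<le> s" if "2 * \<bar>x\<bar> < circ_dist f t" for t
      using that circ_dist_antimono[of s t] by linarith
    then have "?P \<subseteq> {0<..s}" by auto
    then have "measure lborel ?P \<le> measure lborel {0<..s}"
      using assms by (intro measure_mono_fmeasurable) (auto simp: fmeasurable_def)
    then show False using that assms by (simp add: circ_rearr_eq_measure)
  qed
  show "s < circ_rearr f x" if less: "2 * \<bar>x\<bar> < circ_dist f s"
  proof -
    obtain t where t: "s < t" "2 * \<bar>x\<bar> < circ_dist f t" by (rule circ_dist_right_cont[OF less])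
    obtain N where N: "circ_dist f N < 2 * \<bar>x\<bar>"
      using assms by (auto intro: circ_dist_vanishes[of "2 * \<bar>x\<bar>"])
    have "t \<le> N" if "2 * \<bar>x\<bar> < circ_dist f t" for t
      using that N circ_dist_antimono[of N t] by linarith
    then have "?P \<subseteq> {0..N}" by auto
    moreover have "{0..N} \<in> fmeasurable lborel"
      by (simp add: fmeasurable_def emeasure_lborel_Icc_eq)
    ultimately have "?P \<in> fmeasurable lborel"
      by (intro fmeasurableI2[of "{0..N}" lborel ?P]) simp_all
    moreover have "{0<..t} \<subseteq> ?P"
    proof
      fix r assume "r \<in> {0<..t}"
      then show "r \<in> ?P" using t(2) circ_dist_antimono[of r t] by simp
    qed
    ultimately have "measure lborel {0<..t} \<le> measure lborel ?P"
      by (intro measure_mono_fmeasurable) auto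
    then show ?thesis using t assms by (simp add: circ_rearr_eq_measure)
  qed
qed

lemma circ_rearr_measurable [measurable]: "circ_rearr f \<in> borel_measurable circ"
  unfolding borel_measurable_iff_greater
proof
  fix s
  show "{x \<in> space circ. s < circ_rearr f x} \<in> sets circ"
  proof (cases "0 \<le> s")
    case True
    have "{x \<in> space circ. s < circ_rearr f x} =
        {x \<in> space circ. x \<noteq> 0 \<and> 2 * \<bar>x\<bar> < circ_dist f s} \<union>
        {x \<in> space circ. x = 0 \<and> s < circ_rearr f 0}"
      by (rule set_eqI, case_tac "x = 0") (auto simp: less_circ_rearr_iff[OF _ True])
    also have "\<dots> \<in> sets circ" by measurable
    finally show ?thesis .
  next
    case False
    then have "{x \<in> space circ. s < circ_rearr f x} = space circ"
      using circ_rearr_nonneg by (auto intro: less_le_trans simp: not_le)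
    then show ?thesis by (metis sets.top)
  qed
qed

end

section \<open>Bathtub principle and layer-cake formula\<close>

lemma AE_circ_neq: "AE x in circ. x \<noteq> c"
proof -
  have "AE x in lebesgue. x \<noteq> c" using AE_lborel_singleton[of c] by (rule AE_completion)
  then show ?thesis by (auto simp: AE_restrict_space_iff)
qed

lemma measure_circ_symmetric_interval:
  assumes "0 \<le> a" "a \<le> pi"
  shows "measure circ {x \<in> space circ. \<bar>x\<bar> < a} = 2 * a"
proof -
  have "{x \<in> space circ. \<bar>x\<bar> < a} = {-a<..<a}" using assms by auto
  moreover have "{-a<..<a} \<subseteq> {-pi<..<pi}" using assms by auto
  ultimately show ?thesis using assms by (simp add: measure_restrict_space)
qed

text \<open>\<open>E\<close> and the centred interval have equal measure, so subtracting the
  constant \<open>v a\<close> from the weight leaves the difference unchanged. The boundary value is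
  chosen to give the new integrand a sign.\<close>

lemma bathtub_identity:
  fixes v :: "real \<Rightarrow> real"
  assumes v: "integrable circ (\<lambda>x. v \<bar>x\<bar>)" and E [measurable]: "E \<in> sets circ"
  defines "a \<equiv> measure circ E / 2"
  shows "(LINT x|circ. v \<bar>x\<bar> * indicator E x) - (LINT x|circ. v \<bar>x\<bar> * indicator {x. \<bar>x\<bar> < a} x)
    = (LINT x|circ. (v \<bar>x\<bar> - v a) * (indicator E x - indicator {x. \<bar>x\<bar> < a} x))"
    and "integrable circ (\<lambda>x. (v \<bar>x\<bar> - v a) * (indicator E x - indicator {x. \<bar>x\<bar> < a} x))"
proof -
  have a: "0 \<le> a" "a \<le> pi"
    using circ.bounded_measure[of E] by (auto simp: a_def measure_restrict_space)
  have [measurable]: "(\<lambda>x. indicator {x. \<bar>x\<bar> < a} x :: real) \<in> borel_measurable circ"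
    by measurable
  have iE: "integrable circ (\<lambda>x. v \<bar>x\<bar> * indicator E x)" 
    using integrable_mult_indicator[OF E v] by (simp add: mult.commute)
  have iB: "integrable circ (\<lambda>x. v \<bar>x\<bar> * indicator {x. \<bar>x\<bar> < a} x)"
    using v by (intro Bochner_Integration.integrable_bound[OF v]) (auto simp: indicator_def)
  have jE: "integrable circ (\<lambda>x. v a * indicator E x)"
    by (intro integrable_mult_right circ.integrable_const_bound[of _ 1]) (auto simp: indicator_def)
  have jB: "integrable circ (\<lambda>x. v a * indicator {x. \<bar>x\<bar> < a} x)"
    by (intro integrable_mult_right circ.integrable_const_bound[of _ 1]) (auto simp: indicator_def)
  have split: "(v \<bar>x\<bar> - v a) * (indicator E x - indicator {x. \<bar>x\<bar> < a} x) =
      (v \<bar>x\<bar> * indicator E x - v \<bar>x\<bar> * indicator {x. \<bar>x\<bar> < a} x)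
      - (v a * indicator E x - v a * indicator {x. \<bar>x\<bar> < a} x)" for x
    by (simp add: algebra_simps)
  show "integrable circ (\<lambda>x. (v \<bar>x\<bar> - v a) * (indicator E x - indicator {x. \<bar>x\<bar> < a} x))"
    unfolding split using iE iB jE jB by (intro Bochner_Integration.integrable_diff)
  have "(LINT x|circ. indicat_real {x. \<bar>x\<bar> < a} x) = (LINT x|circ. indicator {x \<in> space circ. \<bar>x\<bar> < a} x)"
    by (intro Bochner_Integration.integral_cong) (auto simp: indicator_def)
  also have "\<dots> = 2 * a"
    using measure_circ_symmetric_interval[OF a]
    by (subst Bochner_Integration.integral_indicator) (simp add: Int_absorb2 subset_eq)
  also have "2 * a = (LINT x|circ. indicat_real E x)"
    using sets.sets_into_space[OF E] by (simp add: a_def Int_absorb2)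
  finally have "(LINT x|circ. v a * indicator {x. \<bar>x\<bar> < a} x) = (LINT x|circ. v a * indicator E x)"
    by (simp only: integral_mult_right_zero)
  then show "(LINT x|circ. v \<bar>x\<bar> * indicator E x) - (LINT x|circ. v \<bar>x\<bar> * indicator {x. \<bar>x\<bar> < a} x)
    = (LINT x|circ. (v \<bar>x\<bar> - v a) * (indicator E x - indicator {x. \<bar>x\<bar> < a} x))"
    unfolding split using iE iB jE jB by (simp only: Bochner_Integration.integral_diff Bochner_Integration.integrable_diff)
qed

text \<open>Both factors of the integrand in \<open>bathtub_identity\<close> are nonpositive for |x|
  < a and nonnegative beyond, so the product is nonnegative. If its integral is 0, strictness makes
  the weight factor nonzero off the two points with |x| = a, and the indicators must agree.\<close>

lemma bathtub:
  fixes v :: "real \<Rightarrow> real"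
  assumes v: "integrable circ (\<lambda>x. v \<bar>x\<bar>)" and E [measurable]: "E \<in> sets circ"
    and mono: "mono_on {0..pi} v"
  defines "a \<equiv> measure circ E / 2"
  shows "(LINT x|circ. v \<bar>x\<bar> * indicator {x. \<bar>x\<bar> < a} x) \<le> (LINT x|circ. v \<bar>x\<bar> * indicator E x)"
    and "strict_mono_on {0..pi} v \<Longrightarrow>
      (LINT x|circ. v \<bar>x\<bar> * indicator {x. \<bar>x\<bar> < a} x) = (LINT x|circ. v \<bar>x\<bar> * indicator E x) \<Longrightarrow>
      AE x in circ. x \<in> E \<longleftrightarrow> \<bar>x\<bar> < a"
proof -
  let ?D = "\<lambda>x. (v \<bar>x\<bar> - v a) * (indicator E x - indicator {x. \<bar>x\<bar> < a} x)"
  have a: "0 \<le> a" "a \<le> pi"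
    using circ.bounded_measure[of E] by (auto simp: a_def measure_restrict_space)
  have nonneg: "0 \<le> ?D x" if "x \<in> space circ" for x
  proof (cases "\<bar>x\<bar> < a")
    case True
    then have "v \<bar>x\<bar> \<le> v a" using a by (intro mono_onD[OF mono]) auto
    then show ?thesis using True by (auto simp: indicator_def)
  next
    case False
    then have "v a \<le> v \<bar>x\<bar>" using a that by (intro mono_onD[OF mono]) auto
    then show ?thesis using False by (auto simp: indicator_def)
  qed
  note id = bathtub_identity[OF v E, folded a_def]
  show "(LINT x|circ. v \<bar>x\<bar> * indicator {x. \<bar>x\<bar> < a} x) \<le> (LINT x|circ. v \<bar>x\<bar> * indicator E x)"
    using id(1) Bochner_Integration.integral_nonneg[of circ ?D] nonneg by simp
  assume sm: "strict_mono_on {0..pi} v"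
    and "(LINT x|circ. v \<bar>x\<bar> * indicator {x. \<bar>x\<bar> < a} x) = (LINT x|circ. v \<bar>x\<bar> * indicator E x)"
  then have "(LINT x|circ. ?D x) = 0" using id(1) by simp
  then have "AE x in circ. ?D x = 0"
    using integral_nonneg_eq_0_iff_AE[OF id(2) AE_I2[OF nonneg]] by blast
  moreover have "AE x in circ. x \<noteq> a" "AE x in circ. x \<noteq> -a" by (rule AE_circ_neq)+
  ultimately show "AE x in circ. x \<in> E \<longleftrightarrow> \<bar>x\<bar> < a"
    using AE_space
  proof eventually_elim
    case (elim x)
    have "\<bar>x\<bar> \<in> {0..pi}" "a \<in> {0..pi}" "\<bar>x\<bar> \<noteq> a" using elim a by auto
    then have "v \<bar>x\<bar> \<noteq> v a"
      using strict_mono_on_eqD[OF sm, of a "\<bar>x\<bar>"] by metis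
    then have "indicat_real E x = indicator {x. \<bar>x\<bar> < a} x" using elim(1) by simp
    then show ?case by (simp add: indicator_def of_bool_eq_iff)
  qed
qed

interpretation circ_lborel: pair_sigma_finite circ lborel ..

text \<open>\<open>G x\<close> is the length of \<open>{0..<G x}\<close>; Tonelli exchanges the
  integrals over points and levels.\<close>

lemma layer_cake:
  assumes [measurable]: "w \<in> borel_measurable circ" "G \<in> borel_measurable circ"
    and w: "\<And>x. x \<in> space circ \<Longrightarrow> 0 \<le> w x" and G: "\<And>x. x \<in> space circ \<Longrightarrow> 0 \<le> (G x :: real)"
  shows "(\<integral>\<^sup>+x. ennreal (w x * G x) \<partial>circ)
    = (\<integral>\<^sup>+t. indicator {0..} t * (\<integral>\<^sup>+x. ennreal (w x * indicator {x. t < G x} x) \<partial>circ) \<partial>lborel)"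
proof -
  have "(\<integral>\<^sup>+x. ennreal (w x * G x) \<partial>circ)
      = (\<integral>\<^sup>+x. \<integral>\<^sup>+t. indicator {0..} t * ennreal (w x * indicator {x. t < G x} x) \<partial>lborel \<partial>circ)"
  proof (rule nn_integral_cong)
    fix x assume x: "x \<in> space circ"
    have "(\<integral>\<^sup>+t. indicator {0..} t * ennreal (w x * indicator {x. t < G x} x) \<partial>lborel)
        = (\<integral>\<^sup>+t. ennreal (w x) * indicator {0..<G x} t \<partial>lborel)"
      by (intro nn_integral_cong) (auto simp: indicator_def)
    also have "\<dots> = ennreal (w x * G x)"
      using w[OF x] G[OF x] by (simp add: nn_integral_cmult ennreal_mult)
    finally show "ennreal (w x * G x)
        = (\<integral>\<^sup>+t. indicator {0..} t * ennreal (w x * indicator {x. t < G x} x) \<partial>lborel)" ..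
  qed
  also have "\<dots> = (\<integral>\<^sup>+t. \<integral>\<^sup>+x. indicator {0..} t * ennreal (w x * indicator {x. t < G x} x) \<partial>circ \<partial>lborel)"
    by (rule circ_lborel.Fubini' [symmetric]) (measurable)
  also have "\<dots> = (\<integral>\<^sup>+t. indicator {0..} t * (\<integral>\<^sup>+x. ennreal (w x * indicator {x. t < G x} x) \<partial>circ) \<partial>lborel)"
    by (intro nn_integral_cong nn_integral_cmult) measurable
  finally show ?thesis .
qed

section \<open>Weighted rearrangement inequality\<close>

lemma indicator_times_mono:
  fixes a b :: ennreal
  assumes "t \<in> A \<Longrightarrow> a \<le> b"
  shows "indicator A t * a \<le> indicator A t * b"
  using assms by (cases "t \<in> A") auto

lemma indicator_times_cong:
  fixes a b :: ennreal
  assumes "t \<in> A \<Longrightarrow> a = b"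
  shows "indicator A t * a = indicator A t * b"
  using assms by (cases "t \<in> A") auto

context
  fixes f :: "real \<Rightarrow> complex" and v :: "real \<Rightarrow> real"
  assumes f: "square_integrable f"
    and mono: "mono_on {0..pi} v"
    and v_nonneg: "\<And>r. r \<in> {0..pi} \<Longrightarrow> 0 \<le> v r"
    and v_measurable: "(\<lambda>x. v \<bar>x\<bar>) \<in> borel_measurable circ"
begin

lemma weight_bounds: "x \<in> space circ \<Longrightarrow> 0 \<le> v \<bar>x\<bar> \<and> v \<bar>x\<bar> \<le> v pi"
  using v_nonneg mono_onD[OF mono, of "\<bar>x\<bar>" pi] by auto

lemma weight_integrable: "integrable circ (\<lambda>x. v \<bar>x\<bar>)"
  using v_measurable weight_bounds by (intro circ.integrable_const_bound[of _ "v pi"]) auto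

lemma f_measurable: "f \<in> borel_measurable circ"
  using f by (rule square_integrable_measurable)

text \<open>Level \<open>t\<close> of the square is level \<open>sqrt t\<close> of the modulus. The
  real-valued integral is the form in which \<open>bathtub\<close> is stated.\<close>

lemma level_integral_f:
  "(\<integral>\<^sup>+x. ennreal (v \<bar>x\<bar> * indicator {x. t < (cmod (f x))\<^sup>2} x) \<partial>circ)
    = ennreal (LINT x|circ. v \<bar>x\<bar> * indicator {x \<in> space circ. sqrt t < cmod (f x)} x)" if "0 \<le> t"
proof -
  note [measurable] = f_measurable v_measurable
  have "(\<integral>\<^sup>+x. ennreal (v \<bar>x\<bar> * indicator {x. t < (cmod (f x))\<^sup>2} x) \<partial>circ)
      = (\<integral>\<^sup>+x. ennreal (v \<bar>x\<bar> * indicator {x \<in> space circ. sqrt t < cmod (f x)} x) \<partial>circ)"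
    using real_sqrt_less_iff[of t "(cmod (f _))\<^sup>2"] by (intro nn_integral_cong) (simp add: indicator_def)
  also have "\<dots> = ennreal (LINT x|circ. v \<bar>x\<bar> * indicator {x \<in> space circ. sqrt t < cmod (f x)} x)"
    using weight_bounds integrable_mult_indicator[OF _ weight_integrable, of "{x \<in> space circ. sqrt t < cmod (f x)}"]
    by (intro nn_integral_eq_integral AE_I2) (auto simp: mult.commute circ_level_sets[OF f_measurable])
  finally show ?thesis .
qed

text \<open>Off the point 0 the level set of the rearrangement is the very interval with which
  \<open>bathtub\<close> compares the level set of \<open>f\<close>.\<close>

lemma level_integral_rearr:
  "(\<integral>\<^sup>+x. ennreal (v \<bar>x\<bar> * indicator {x. t < (circ_rearr f x)\<^sup>2} x) \<partial>circ)
    = ennreal (LINT x|circ. v \<bar>x\<bar> * indicator {x. \<bar>x\<bar> < circ_dist f (sqrt t) / 2} x)" if "0 \<le> t"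
proof -
  note [measurable] = f_measurable v_measurable circ_rearr_measurable[OF f_measurable]
  have "AE x in circ. v \<bar>x\<bar> * indicator {x. t < (circ_rearr f x)\<^sup>2} x
      = v \<bar>x\<bar> * indicator {x. \<bar>x\<bar> < circ_dist f (sqrt t) / 2} x"
    using AE_circ_neq[of 0]
  proof eventually_elim
    case (elim x)
    have "t < (circ_rearr f x)\<^sup>2 \<longleftrightarrow> sqrt t < circ_rearr f x"
      using real_sqrt_less_iff[of t "(circ_rearr f x)\<^sup>2"] circ_rearr_nonneg[OF f_measurable, of x] by simp
    also have "\<dots> \<longleftrightarrow> \<bar>x\<bar> < circ_dist f (sqrt t) / 2"
      using less_circ_rearr_iff[OF f_measurable elim, of "sqrt t"] that by auto
    finally show ?case by (simp add: indicator_def)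
  qed
  then have "(\<integral>\<^sup>+x. ennreal (v \<bar>x\<bar> * indicator {x. t < (circ_rearr f x)\<^sup>2} x) \<partial>circ)
      = (\<integral>\<^sup>+x. ennreal (v \<bar>x\<bar> * indicator {x. \<bar>x\<bar> < circ_dist f (sqrt t) / 2} x) \<partial>circ)"
    by (intro nn_integral_cong_AE) (erule eventually_mono, simp only:)
  also have "\<dots> = ennreal (LINT x|circ. v \<bar>x\<bar> * indicator {x. \<bar>x\<bar> < circ_dist f (sqrt t) / 2} x)"
  proof (rule nn_integral_eq_integral)
    show "integrable circ (\<lambda>x. v \<bar>x\<bar> * indicator {x. \<bar>x\<bar> < circ_dist f (sqrt t) / 2} x)"
      by (rule Bochner_Integration.integrable_bound[OF weight_integrable]) (auto simp: indicator_def)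
  qed (use weight_bounds in auto)
  finally show ?thesis .
qed

lemma level_integral_le:
  assumes "0 \<le> t"
  shows "(\<integral>\<^sup>+x. ennreal (v \<bar>x\<bar> * indicator {x. t < (circ_rearr f x)\<^sup>2} x) \<partial>circ)
    \<le> (\<integral>\<^sup>+x. ennreal (v \<bar>x\<bar> * indicator {x. t < (cmod (f x))\<^sup>2} x) \<partial>circ)"
proof -
  have E: "{x \<in> space circ. sqrt t < cmod (f x)} \<in> sets circ"
    using circ_level_sets[OF f_measurable] by simp
  show ?thesis
    unfolding level_integral_f[OF assms] level_integral_rearr[OF assms] circ_dist_def
    by (intro ennreal_leI bathtub(1)[OF weight_integrable E mono])
qed

lemma nn_integral_f_levels:
  "(\<integral>\<^sup>+x. ennreal (v \<bar>x\<bar> * (cmod (f x))\<^sup>2) \<partial>circ)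
    = (\<integral>\<^sup>+t. indicator {0..} t * (\<integral>\<^sup>+x. ennreal (v \<bar>x\<bar> * indicator {x. t < (cmod (f x))\<^sup>2} x) \<partial>circ) \<partial>lborel)"
proof -
  note [measurable] = f_measurable
  show ?thesis using weight_bounds v_measurable by (intro layer_cake) auto
qed

lemma nn_integral_rearr_levels:
  "(\<integral>\<^sup>+x. ennreal (v \<bar>x\<bar> * (circ_rearr f x)\<^sup>2) \<partial>circ)
    = (\<integral>\<^sup>+t. indicator {0..} t * (\<integral>\<^sup>+x. ennreal (v \<bar>x\<bar> * indicator {x. t < (circ_rearr f x)\<^sup>2} x) \<partial>circ) \<partial>lborel)"
proof -
  note [measurable] = circ_rearr_measurable[OF f_measurable]
  show ?thesis using weight_bounds v_measurable by (intro layer_cake) auto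
qed

lemma rearr_inequality:
  "(\<integral>\<^sup>+x. ennreal (v \<bar>x\<bar> * (circ_rearr f x)\<^sup>2) \<partial>circ) \<le> (\<integral>\<^sup>+x. ennreal (v \<bar>x\<bar> * (cmod (f x))\<^sup>2) \<partial>circ)"
  unfolding nn_integral_rearr_levels nn_integral_f_levels
  by (rule nn_integral_mono, rule indicator_times_mono, rule level_integral_le) simp

lemma nn_integral_f_finite: "(\<integral>\<^sup>+x. ennreal (v \<bar>x\<bar> * (cmod (f x))\<^sup>2) \<partial>circ) < \<infinity>"
proof -
  have "(\<integral>\<^sup>+x. ennreal (v \<bar>x\<bar> * (cmod (f x))\<^sup>2) \<partial>circ) \<le> (\<integral>\<^sup>+x. ennreal (v pi * (cmod (f x))\<^sup>2) \<partial>circ)"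
    using weight_bounds by (intro nn_integral_mono ennreal_leI mult_right_mono) auto
  also have "\<dots> = ennreal (LINT x|circ. v pi * (cmod (f x))\<^sup>2)"
    using f v_nonneg by (intro nn_integral_eq_integral) (auto simp: square_integrable_def)
  finally show ?thesis by (auto intro: le_less_trans)
qed

text \<open>For a constant weight the factor \<open>v \<bar>x\<bar> - v a\<close> in
  \<open>bathtub_identity\<close> vanishes. With weight 1 this says that rearrangement preserves the
  L2 norm.\<close>

lemma rearr_equality_const:
  assumes "\<And>r. v r = c"
  shows "(\<integral>\<^sup>+x. ennreal (v \<bar>x\<bar> * (circ_rearr f x)\<^sup>2) \<partial>circ) = (\<integral>\<^sup>+x. ennreal (v \<bar>x\<bar> * (cmod (f x))\<^sup>2) \<partial>circ)"
proof -
  have levels: "(\<integral>\<^sup>+x. ennreal (v \<bar>x\<bar> * indicator {x. t < (circ_rearr f x)\<^sup>2} x) \<partial>circ)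
    = (\<integral>\<^sup>+x. ennreal (v \<bar>x\<bar> * indicator {x. t < (cmod (f x))\<^sup>2} x) \<partial>circ)" if t: "0 \<le> t" for t
  proof -
    have E: "{x \<in> space circ. sqrt t < cmod (f x)} \<in> sets circ"
      using circ_level_sets[OF f_measurable] by simp
    have "(LINT x|circ. v \<bar>x\<bar> * indicator {x \<in> space circ. sqrt t < cmod (f x)} x)
        - (LINT x|circ. v \<bar>x\<bar> * indicator {x. \<bar>x\<bar> < circ_dist f (sqrt t) / 2} x) = 0"
      unfolding circ_dist_def bathtub_identity(1)[OF weight_integrable E] unfolding assms by simp
    then show ?thesis
      unfolding level_integral_f[OF t] level_integral_rearr[OF t] right_minus_eq by (simp only:)
  qed
  show ?thesis
    unfolding nn_integral_rearr_levels nn_integral_f_levels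
    by (rule nn_integral_cong, rule indicator_times_cong, rule levels) simp
qed

text \<open>Equality forces almost every pair of super-level sets to agree up to null sets; exchanging
  the order of the two almost-everywhere quantifiers gives equality of the functions.\<close>

lemma rearr_equality_strict:
  assumes strict: "strict_mono_on {0..pi} v"
    and eq: "(\<integral>\<^sup>+x. ennreal (v \<bar>x\<bar> * (circ_rearr f x)\<^sup>2) \<partial>circ) = (\<integral>\<^sup>+x. ennreal (v \<bar>x\<bar> * (cmod (f x))\<^sup>2) \<partial>circ)"
  shows "AE x in circ. cmod (f x) = circ_rearr f x"
proof -
  note [measurable] = f_measurable v_measurable circ_rearr_measurable[OF f_measurable]
  define J where "J g t = indicator {0..} t * (\<integral>\<^sup>+x. ennreal (v \<bar>x\<bar> * indicator {x. t < g x} x) \<partial>circ)"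
    for g and t :: real
  let ?F = "\<lambda>x. (cmod (f x))\<^sup>2" and ?R = "\<lambda>x. (circ_rearr f x)\<^sup>2"
  have [measurable]: "J ?F \<in> borel_measurable lborel" "J ?R \<in> borel_measurable lborel"
    unfolding J_def by measurable
  have le: "J ?R t \<le> J ?F t" for t
    using level_integral_le[of t] by (simp add: J_def indicator_def)
  have JF: "(\<integral>\<^sup>+t. J ?F t \<partial>lborel) = (\<integral>\<^sup>+x. ennreal (v \<bar>x\<bar> * (cmod (f x))\<^sup>2) \<partial>circ)"
    unfolding J_def nn_integral_f_levels ..
  have JR: "(\<integral>\<^sup>+t. J ?R t \<partial>lborel) = (\<integral>\<^sup>+x. ennreal (v \<bar>x\<bar> * (cmod (f x))\<^sup>2) \<partial>circ)"
    unfolding J_def nn_integral_rearr_levels[symmetric] eq ..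
  \<comment> \<open>Subtraction is legitimate because the smaller integral is finite; it equals that
    of \<open>f\<close> by \<open>eq\<close>.\<close>
  have "(\<integral>\<^sup>+t. J ?F t - J ?R t \<partial>lborel) = (\<integral>\<^sup>+t. J ?F t \<partial>lborel) - (\<integral>\<^sup>+t. J ?R t \<partial>lborel)"
    using nn_integral_f_finite le by (intro nn_integral_diff) (auto simp: JR)
  also have "\<dots> = 0" using nn_integral_f_finite by (simp add: JF JR)
  finally have "AE t in lborel. J ?F t - J ?R t = 0"
    by (subst (asm) nn_integral_0_iff_AE) auto
  then have "AE t in lborel. AE x in circ. 0 \<le> t \<longrightarrow> (t < ?F x \<longleftrightarrow> t < ?R x)"
  proof eventually_elim
    case (elim t)
    show ?case
    proof (cases "0 \<le> t")
      case True
      let ?E = "{x \<in> space circ. sqrt t < cmod (f x)}" and ?a = "circ_dist f (sqrt t) / 2"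
      have E: "?E \<in> sets circ"
        using circ_level_sets[OF f_measurable] by simp
      have JF: "J ?F t = ennreal (LINT x|circ. v \<bar>x\<bar> * indicator ?E x)"
        using True by (simp add: J_def level_integral_f[simplified])
      have JR: "J ?R t = ennreal (LINT x|circ. v \<bar>x\<bar> * indicator {x. \<bar>x\<bar> < ?a} x)"
        using True by (simp add: J_def level_integral_rearr)
      have "J ?R t = J ?F t"
        using elim le[of t] by (simp add: JF JR diff_eq_0_iff_ennreal antisym)
      \<comment> \<open>\<open>ennreal\<close> is injective only on nonnegative reals, so these
        signs are needed to read the equality of levels as one of real integrals.\<close>
      moreover have "0 \<le> (LINT x|circ. v \<bar>x\<bar> * indicator ?E x)"
        "0 \<le> (LINT x|circ. v \<bar>x\<bar> * indicator {x. \<bar>x\<bar> < ?a} x)"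
        using weight_bounds by (auto intro!: integral_nonneg_AE AE_I2)
      ultimately have "AE x in circ. x \<in> ?E \<longleftrightarrow> \<bar>x\<bar> < ?a"
        using bathtub(2)[OF weight_integrable E mono strict] by (simp add: JF JR circ_dist_def)
      then show ?thesis
        using AE_circ_neq[of 0] AE_space
      proof eventually_elim
        case (elim x)
        have "t < ?F x \<longleftrightarrow> sqrt t < cmod (f x)"
          using real_sqrt_less_iff[of t "?F x"] by simp
        also have "\<dots> \<longleftrightarrow> sqrt t < circ_rearr f x"
          using elim less_circ_rearr_iff[OF f_measurable elim(2), of "sqrt t"] True by auto
        also have "\<dots> \<longleftrightarrow> t < ?R x"
          using real_sqrt_less_iff[of t "?R x"] circ_rearr_nonneg[OF f_measurable, of x] by simp
        finally show ?case by simp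
      qed
    qed simp
  qed
  then have "AE x in circ. AE t in lborel. 0 \<le> t \<longrightarrow> (t < ?F x \<longleftrightarrow> t < ?R x)"
    by (subst circ_lborel.AE_commute) measurable
  then show ?thesis
  proof eventually_elim
    case (elim x)
    have empty: False if "a < b" "0 \<le> a" and AE: "AE t in lborel. \<not> (a < t \<and> t < b)" for a b :: real
    proof -
      have "{t \<in> space lborel. \<not> \<not> (a < t \<and> t < b)} = {a<..<b}" by auto
      with AE have "emeasure lborel {a<..<b} = 0"
        by (subst (asm) AE_iff_measurable) auto
      then show False using that by simp
    qed
    \<comment> \<open>If the values differed, all levels strictly between them would violate the
      equivalence, and these fill an interval of positive length.\<close>
    have "?F x = ?R x"
    proof (rule linorder_cases)
      assume less: "?F x < ?R x"
      have "AE t in lborel. \<not> (?F x < t \<and> t < ?R x)"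
        using elim by eventually_elim (use zero_le_power2[of "cmod (f x)"] in linarith)
      with empty[OF less] show ?thesis by simp
    next
      assume less: "?R x < ?F x"
      have "AE t in lborel. \<not> (?R x < t \<and> t < ?F x)"
        using elim by eventually_elim (use zero_le_power2[of "circ_rearr f x"] in linarith)
      with empty[OF less] show ?thesis by simp
    qed
    then show ?case
      using circ_rearr_nonneg[OF f_measurable, of x] by (simp add: power2_eq_iff_nonneg)
  qed
qed

end

lemma square_integrable_circ_rearr:
  assumes "square_integrable f"
  shows "square_integrable (\<lambda>x. of_real (circ_rearr f x))"
proof -
  note [measurable] = assms[THEN square_integrable_measurable]
  have "(\<integral>\<^sup>+x. ennreal (1 * (circ_rearr f x)\<^sup>2) \<partial>circ) = (\<integral>\<^sup>+x. ennreal (1 * (cmod (f x))\<^sup>2) \<partial>circ)"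
    using assms by (intro rearr_equality_const[where v = "\<lambda>_. 1" and c = 1]) (auto simp: mono_on_def)
  moreover have "(\<lambda>x. complex_of_real (circ_rearr f x)) \<in> borel_measurable circ"
    using circ_rearr_measurable by measurable
  ultimately show ?thesis
    using assms by (simp add: square_integrable_iff_nn_integral)
qed

section \<open>Difference operators as multipliers\<close>

lemma bdiff_inv_fourier:
  assumes "integrable circ h"
  shows "bdiff (inv_fourier h) = inv_fourier (\<lambda>x. h x * (1 - char_circ (- 1) x))"
proof
  fix n
  have "char_circ (n - 1) x = char_circ n x * char_circ (- 1) x" for x
    using char_circ_add[of n "-1" x] by simp
  then have "h x * (1 - char_circ (- 1) x) * char_circ n x = h x * char_circ n x - h x * char_circ (n - 1) x" for x
    by (simp add: algebra_simps)
  then show "bdiff (inv_fourier h) n = inv_fourier (\<lambda>x. h x * (1 - char_circ (- 1) x)) n"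
    using integrable_mult_char_circ[OF assms]
    by (simp add: bdiff_def inv_fourier_char_circ right_diff_distrib)
qed

lemma disc_laplacian_inv_fourier:
  assumes "integrable circ h"
  shows "disc_laplacian (inv_fourier h) = inv_fourier (\<lambda>x. h x * of_real (2 - 2 * cos x))"
proof
  fix n
  have cos: "of_real (2 - 2 * cos x) = 2 - (char_circ 1 x + char_circ (- 1) x)" for x
    by (simp add: char_circ_cis complex_eq_iff)
  have shift: "char_circ (n - 1) x = char_circ n x * char_circ (- 1) x"
     "char_circ (n + 1) x = char_circ n x * char_circ 1 x" for x
    using char_circ_add[of n "-1" x] char_circ_add[of n 1 x] by simp_all
  have "h x * of_real (2 - 2 * cos x) * char_circ n x
      = 2 * (h x * char_circ n x) - h x * char_circ (n - 1) x - h x * char_circ (n + 1) x" for x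
    unfolding cos shift by (simp only: algebra_simps)
  then show "disc_laplacian (inv_fourier h) n = inv_fourier (\<lambda>x. h x * of_real (2 - 2 * cos x)) n"
    using integrable_mult_char_circ[OF assms]
    by (simp add: disc_laplacian_def inv_fourier_char_circ right_diff_distrib)
qed

lemma square_integrable_mult_weight:
  assumes "square_integrable h"
  shows "square_integrable (\<lambda>x. h x * of_real ((2 - 2 * cos x) ^ k))"
proof (rule square_integrable_bounded_mult[OF assms])
  show "(\<lambda>x. complex_of_real ((2 - 2 * cos x) ^ k)) \<in> borel_measurable circ"
    by (intro measurable_circ_borel) measurable
  fix x :: real
  have "\<bar>2 - 2 * cos x\<bar> \<le> 4" using cos_ge_minus_one[of x] cos_le_one[of x] by linarith
  then show "cmod (of_real ((2 - 2 * cos x) ^ k)) \<le> 4 ^ k"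
    by (simp only: norm_of_real power_abs power_mono abs_ge_zero)
qed

lemma disc_laplacian_pow_inv_fourier:
  assumes "square_integrable h"
  shows "(disc_laplacian ^^ k) (inv_fourier h) = inv_fourier (\<lambda>x. h x * of_real ((2 - 2 * cos x) ^ k))"
proof (induction k)
  case (Suc k)
  show ?case
    using disc_laplacian_inv_fourier[OF square_integrable_imp_integrable[OF square_integrable_mult_weight[OF assms, of k]]]
    by (simp add: Suc.IH mult_ac)
qed simp

text \<open>The cosine is taken at |x| so that the weight has the radial form
  \<open>v \<bar>x\<bar>\<close> of the rearrangement inequality.\<close>

lemma sq_sum_disc_laplacian:
  assumes "square_integrable h"
  shows "sq_sum ((disc_laplacian ^^ k) (inv_fourier h))
    = (\<integral>\<^sup>+x. ennreal ((2 - 2 * cos \<bar>x\<bar>) ^ (2 * k) * (cmod (h x))\<^sup>2) \<partial>circ)"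
proof -
  have "(cmod (h x * of_real ((2 - 2 * cos x) ^ k)))\<^sup>2 = (2 - 2 * cos \<bar>x\<bar>) ^ (2 * k) * (cmod (h x))\<^sup>2" for x
    unfolding norm_mult norm_of_real power_mult_distrib power2_abs power_mult [symmetric] cos_abs_real
    by (simp add: mult_ac)
  then show ?thesis
    unfolding disc_laplacian_pow_inv_fourier[OF assms] parseval[OF square_integrable_mult_weight[OF assms]]
    by simp
qed

lemma sq_sum_bdiff_disc_laplacian:
  assumes "square_integrable h"
  shows "sq_sum (bdiff ((disc_laplacian ^^ k) (inv_fourier h)))
    = (\<integral>\<^sup>+x. ennreal ((2 - 2 * cos \<bar>x\<bar>) ^ (2 * k + 1) * (cmod (h x))\<^sup>2) \<partial>circ)"
proof -
  let ?g = "\<lambda>x. h x * of_real ((2 - 2 * cos x) ^ k)"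
  have g: "square_integrable ?g" by (rule square_integrable_mult_weight[OF assms])
  have gb: "square_integrable (\<lambda>x. ?g x * (1 - char_circ (- 1) x))"
  proof (rule square_integrable_bounded_mult[OF g])
    show "cmod (1 - char_circ (- 1) x) \<le> 2" for x
      using norm_triangle_ineq4[of 1 "char_circ (- 1) x"] by simp
  qed measurable
  have "(cmod (1 - char_circ (- 1) x))\<^sup>2 = 2 - 2 * cos x" for x
    using sin_cos_squared_add[of x]
    unfolding cmod_power2 char_circ_cis by (simp add: power2_diff)
  then have "(cmod (?g x * (1 - char_circ (- 1) x)))\<^sup>2 = (2 - 2 * cos \<bar>x\<bar>) ^ (2 * k + 1) * (cmod (h x))\<^sup>2" for x
    unfolding norm_mult norm_of_real power_mult_distrib power2_abs power_mult [symmetric] cos_abs_real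
    by (simp add: mult_ac)
  then show ?thesis
    unfolding disc_laplacian_pow_inv_fourier[OF assms]
      bdiff_inv_fourier[OF square_integrable_imp_integrable[OF g]] parseval[OF gb] by simp
qed

section \<open>The cosine weight and the two inequalities\<close>

lemma cos_weight:
  fixes m :: nat
  shows "mono_on {0..pi} (\<lambda>r. (2 - 2 * cos r) ^ m)"
    and "0 < m \<Longrightarrow> strict_mono_on {0..pi} (\<lambda>r. (2 - 2 * cos r) ^ m)"
    and "0 \<le> (2 - 2 * cos (r :: real)) ^ m"
    and "(\<lambda>x. (2 - 2 * cos \<bar>x\<bar>) ^ m) \<in> borel_measurable circ"
proof -
  show "0 \<le> (2 - 2 * cos r) ^ m" by simp
  show "mono_on {0..pi} (\<lambda>r. (2 - 2 * cos r) ^ m)"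
    by (intro mono_onI power_mono) (auto intro!: cos_monotone_0_pi_le)
  show "0 < m \<Longrightarrow> strict_mono_on {0..pi} (\<lambda>r. (2 - 2 * cos r) ^ m)"
    by (intro strict_mono_onI power_strict_mono) (auto intro!: cos_monotone_0_pi)
  show "(\<lambda>x. (2 - 2 * cos \<bar>x\<bar>) ^ m) \<in> borel_measurable circ"
    by (intro measurable_circ_borel) measurable
qed

lemma weighted_rearr:
  fixes m :: nat
  assumes f: "square_integrable f"
  defines "I \<equiv> \<lambda>g. (\<integral>\<^sup>+x. ennreal ((2 - 2 * cos \<bar>x\<bar>) ^ m * (cmod (g x))\<^sup>2) \<partial>circ)"
  shows "I (\<lambda>x. of_real (circ_rearr f x)) \<le> I f"
    and "I f = I (\<lambda>x. of_real (circ_rearr f x)) \<longleftrightarrow> m = 0 \<or> (AE x in circ. cmod (f x) = circ_rearr f x)"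
proof -
  note v = cos_weight(1,3,4)[where m = m]
  show "I (\<lambda>x. of_real (circ_rearr f x)) \<le> I f"
    using rearr_inequality[OF f v(1) v(2) v(3)] by (simp add: I_def)
  have "I f = I (\<lambda>x. of_real (circ_rearr f x))" if "m = 0"
    using rearr_equality_const[OF f v(1) v(2) v(3), of 1] that by (simp add: I_def)
  moreover have "I f = I (\<lambda>x. of_real (circ_rearr f x))" if "AE x in circ. cmod (f x) = circ_rearr f x"
    unfolding I_def by (rule nn_integral_cong_AE) (use that in \<open>eventually_elim, simp\<close>)
  moreover have "AE x in circ. cmod (f x) = circ_rearr f x"
    if "I f = I (\<lambda>x. of_real (circ_rearr f x))" "m \<noteq> 0"
    using rearr_equality_strict[OF f v(1) v(2) v(3) cos_weight(2)[where m = m]] that by (simp add: I_def)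
  ultimately show "I f = I (\<lambda>x. of_real (circ_rearr f x)) \<longleftrightarrow> m = 0 \<or> (AE x in circ. cmod (f x) = circ_rearr f x)"
    by blast
qed

theorem theorem4p5:
  fixes u :: "int \<Rightarrow> complex" and k :: nat
  assumes "u \<in> ell2"
  shows
    "sq_sum ((disc_laplacian ^^ k) u) \<ge> sq_sum ((disc_laplacian ^^ k) (fourier_rearr u))
     \<and> sq_sum (bdiff ((disc_laplacian ^^ k) u))
         \<ge> sq_sum (bdiff ((disc_laplacian ^^ k) (fourier_rearr u)))
     \<and> (sq_sum ((disc_laplacian ^^ k) u) = sq_sum ((disc_laplacian ^^ k) (fourier_rearr u))
         \<longleftrightarrow> k = 0 \<or> (AE x in circ. cmod (fourier u x) = circ_rearr (fourier u) x))
     \<and> (sq_sum (bdiff ((disc_laplacian ^^ k) u))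
           = sq_sum (bdiff ((disc_laplacian ^^ k) (fourier_rearr u)))
         \<longleftrightarrow> (AE x in circ. cmod (fourier u x) = circ_rearr (fourier u) x))"
proof -
  let ?f = "fourier u" and ?g = "\<lambda>x. complex_of_real (circ_rearr (fourier u) x)"
  have fourier: "is_fourier u ?f" using assms by (rule is_fourier_fourier)
  then have f: "square_integrable ?f" by (simp add: is_fourier_iff)
  have g: "square_integrable ?g" by (rule square_integrable_circ_rearr[OF f])
  have u: "u = inv_fourier ?f" using inv_fourier_is_fourier[OF fourier] by simp
  note lap = sq_sum_disc_laplacian[OF f, folded u] sq_sum_disc_laplacian[OF g, folded fourier_rearr_def]
  note grad = sq_sum_bdiff_disc_laplacian[OF f, folded u] sq_sum_bdiff_disc_laplacian[OF g, folded fourier_rearr_def]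
  \<comment> \<open>The exponent \<open>2 * k\<close> is 0 exactly for \<open>k = 0\<close>, while
    \<open>2 * k + 1\<close> never is; the exceptional case survives only in the first
    equivalence.\<close>
  show ?thesis
    unfolding lap grad
    using weighted_rearr[OF f, of "2 * k"] weighted_rearr[OF f, of "2 * k + 1"] by simp
qed

end
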